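(* Let $\rightsquigarrow$ be a semi-2-eternal relation, $G$ a finite group, $p$ a prime divisor of $|G|$, and $S$ a Sylow $p$-subgroup of $G$. Suppose that every subgroup $H$ of $S$ of order $p$ satisfies $H\rightsquigarrow G$ and, if $p=2$, every cyclic subgroup $H$ of $S$ of order $4$ satisfies $H\rightsquigarrow G$. Then $\mathcal{F}_S(G)$ is supersolvable.
   Context: All groups are finite. $Z_{\mathfrak{U}}(G)$ denotes the supersolvable hypercenter of $G$: the largest normal subgroup $N$ of $G$ such that every chief factor of $G$ below $N$ is cyclic (of prime order). Let $\rightsquigarrow$ be a relation, defined for every finite group $G$, between subgroups $H\le G$ and $G$ (written $H\rightsquigarrow G$). It is called semi-2-eternal if for every finite group $G$ the following hold: (0) for all subgroups $H\le K\le G$, if $H\rightsquigarrow G$ then $H\rightsquigarrow K$; (2') for every prime divisor $p$ of $|G|$: if every subgroup $H$ of $O_p(G)$ of order $p$ satisfies $H\rightsquigarrow G$ and, in case $p=2$, every cyclic subgroup $H$ of $O_p(G)$ of order $4$ satisfies $H\rightsquigarrow G$, then $O_p(G)\le Z_{\mathfrak{U}}(G)$. $\mathcal{F}_S(G)$ is the (saturated) fusion system on $S\in\mathrm{Syl}_p(G)$ whose objects are the subgroups of $S$ and whose morphisms $P\to Q$ are the maps $x\mapsto x^g$ with $g\in G$, $P^g\le Q$. A saturated fusion system $\mathcal{F}$ on a $p$-group $S$ is supersolvable if there is a series $1=S_0\le S_1\le\cdots\le S_n=S$ of strongly $\mathcal{F}$-closed subgroups of $S$ with $S_{i+1}/S_i$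 cyclic for $0\le i\le n-1$. (A subgroup $T\le S$ is strongly $\mathcal{F}$-closed if for every $P\le T$ and every $\phi\in\mathrm{Hom}_{\mathcal{F}}(P,S)$ one has $P^{\phi}\le T$.) *)

theory Defs
  imports "HOL-Algebra.Algebra"
begin

definition p_subgroup :: "nat \<Rightarrow> 'a set \<Rightarrow> 'a monoid \<Rightarrow> bool" where
  "p_subgroup p H G \<longleftrightarrow> subgroup H G \<and> (\<exists>k. card H = p ^ k)"

definition sylow_subgroup :: "nat \<Rightarrow> 'a set \<Rightarrow> 'a monoid \<Rightarrow> bool" where
  "sylow_subgroup p S G \<longleftrightarrow> subgroup S G \<and> card S = p ^ multiplicity p (order G)"

text \<open>
  The largest normal \<open>p\<close>-subgroup \<open>O\<^sub>p(G)\<close>. \<open>Greatest\<close> is a definite description with respect to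
  inclusion; for finite \<open>G\<close> and prime \<open>p\<close> the greatest element exists because a product of
  normal \<open>p\<close>-subgroups is again one.
\<close>

definition p_core :: "nat \<Rightarrow> 'a monoid \<Rightarrow> 'a set" where
  "p_core p G = (GREATEST N. N \<lhd> G \<and> p_subgroup p N G)"

text \<open>\<open>H/K\<close> is a chief factor of \<open>G\<close>, i.e. a minimal normal subgroup of \<open>G/K\<close>.\<close>

definition chief_factor :: "'a monoid \<Rightarrow> 'a set \<Rightarrow> 'a set \<Rightarrow> bool" where
  "chief_factor G H K \<longleftrightarrow>
     H \<lhd> G \<and> K \<lhd> G \<and> K \<subset> H \<and> (\<forall>L. L \<lhd> G \<and> K \<subseteq> L \<and> L \<subseteq> H \<longrightarrow> L = K \<or> L = H)"

text \<open>
  The supersolvable hypercenter. As for \<open>p_core\<close>, the greatest element exists for finite \<open>G\<close>: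
  a chief factor below \<open>N M\<close> is \<open>G\<close>-isomorphic to one below \<open>N\<close> or to one below \<open>M\<close>.
\<close>

definition supersolvable_hypercenter :: "'a monoid \<Rightarrow> 'a set" where
  "supersolvable_hypercenter G =
     (GREATEST N. N \<lhd> G \<and>
        (\<forall>H K. chief_factor G H K \<and> H \<subseteq> N \<longrightarrow>
           cyclic_group (G\<lparr>carrier := H\<rparr> Mod K) \<and> Factorial_Ring.prime (order (G\<lparr>carrier := H\<rparr> Mod K))))"

text \<open>
  \<open>R H G\<close> stands for \<open>H \<leadsto> G\<close> and is only ever used when \<open>H\<close> is a subgroup of the finite
  group \<open>G\<close>. The groups range over all finite groups with elements in the type \<open>'a\<close>, a class
  closed under subgroups. This is no restriction: a relation satisfying the conditions on such
  groups extends to all finite groups by making it false on the others, where the second condition then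
  only concerns groups with trivial \<open>O\<^sub>p(G)\<close>.
\<close>

definition semi_2_eternal :: "('a set \<Rightarrow> 'a monoid \<Rightarrow> bool) \<Rightarrow> bool" where
  "semi_2_eternal R \<longleftrightarrow>
     (\<forall>G. group G \<and> finite (carrier G) \<longrightarrow>
        (\<forall>H K. subgroup H G \<and> subgroup K G \<and> H \<subseteq> K \<and> R H G \<longrightarrow> R H (G\<lparr>carrier := K\<rparr>)) \<and>
        (\<forall>p. Factorial_Ring.prime p \<and> p dvd order G \<and>
             (\<forall>H. subgroup H G \<and> H \<subseteq> p_core p G \<and> card H = p \<longrightarrow> R H G) \<and>
             (p = 2 \<longrightarrow> (\<forall>H. subgroup H G \<and> H \<subseteq> p_core p G \<and>
                card H = 4 \<and> cyclic_group (G\<lparr>carrier := H\<rparr>) \<longrightarrow> R H G))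
           \<longrightarrow> p_core p G \<subseteq> supersolvable_hypercenter G))"

text \<open>
  The data of a fusion system: the underlying \<open>p\<close>-group, whose subgroups are the objects, and the
  morphism sets. A morphism from \<open>P\<close> is represented by a function that is \<open>undefined\<close> off \<open>P\<close>.
\<close>

record 'a fusion_system =
  Base :: "'a monoid"
  Mor :: "'a set \<Rightarrow> 'a set \<Rightarrow> ('a \<Rightarrow> 'a) set"

definition group_fusion_system :: "'a monoid \<Rightarrow> 'a set \<Rightarrow> 'a fusion_system" where
  "group_fusion_system G S =
     \<lparr>Base = G\<lparr>carrier := S\<rparr>,
      Mor = (\<lambda>P Q. {\<lambda>x\<in>P. inv\<^bsub>G\<^esub> g \<otimes>\<^bsub>G\<^esub> x \<otimes>\<^bsub>G\<^esub> g | g.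
               g \<in> carrier G \<and>
               subgroup P (G\<lparr>carrier := S\<rparr>) \<and> subgroup Q (G\<lparr>carrier := S\<rparr>) \<and>
               (\<lambda>x. inv\<^bsub>G\<^esub> g \<otimes>\<^bsub>G\<^esub> x \<otimes>\<^bsub>G\<^esub> g) ` P \<subseteq> Q})\<rparr>"

definition strongly_closed :: "'a fusion_system \<Rightarrow> 'a set \<Rightarrow> bool" where
  "strongly_closed F T \<longleftrightarrow>
     subgroup T (Base F) \<and>
     (\<forall>P. subgroup P (Base F) \<and> P \<subseteq> T \<longrightarrow>
        (\<forall>\<phi> \<in> Mor F P (carrier (Base F)). \<phi> ` P \<subseteq> T))"

text \<open>
  The normality of \<open>T i\<close> in \<open>T (Suc i)\<close>, needed for the quotient to be a group, is automatic for
  an actual fusion system: its morphisms include conjugation by elements of the underlying group.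
  Saturation is not part of the predicate: the notion is applied to systems \<open>F\<^sub>S(G)\<close> with \<open>S\<close>
  a Sylow subgroup, which are always saturated.
\<close>

definition supersolvable_fusion_system :: "'a fusion_system \<Rightarrow> bool" where
  "supersolvable_fusion_system F \<longleftrightarrow>
     (\<exists>(n::nat) T. T 0 = {\<one>\<^bsub>Base F\<^esub>} \<and> T n = carrier (Base F) \<and>
        (\<forall>i\<le>n. strongly_closed F (T i)) \<and>
        (\<forall>i<n. T i \<subseteq> T (Suc i) \<and> T i \<lhd> (Base F)\<lparr>carrier := T (Suc i)\<rparr> \<and>
               cyclic_group ((Base F)\<lparr>carrier := T (Suc i)\<rparr> Mod T i)))"

end

theory Submission
  imports Defs
begin

text \<open>
  Let \<open>B \<le> S\<close> be such that \<open>N\<^sub>S(B)\<close> is a Sylow subgroup of \<open>N = N\<^sub>G(B)\<close>. Then \<open>O\<^sub>p(N) \<le> S\<close>, so the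
  hypothesis passes from \<open>G\<close> to \<open>N\<close> and gives \<open>B \<le> O\<^sub>p(N) \<le> Z\<^sub>\<UU>(N)\<close>: there is a chain of normal
  subgroups of \<open>N\<close> from \<open>1\<close> to \<open>B\<close> with factors of order \<open>p\<close>. The elements of \<open>N\<close> that centralize all
  these factors form a normal subgroup \<open>D\<close> which contains \<open>C\<^sub>N(B)\<close> and \<open>T = N\<^sub>S(B)\<close> and induces a
  \<open>p\<close>-group on \<open>B\<close>; hence \<open>D = T C\<^sub>N(B)\<close>, and \<open>N = C\<^sub>N(B) N\<^sub>N(T)\<close> by the Frattini argument. As \<open>B < T\<close>
  for \<open>B < S\<close>, downward induction on \<open>|B|\<close>, as in the proof of Alperin's fusion theorem, shows
  that every morphism of \<open>F\<^sub>S(G)\<close> is induced by an element of \<open>N\<^sub>G(S)\<close>. Finally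
  \<open>S \<le> Z\<^sub>\<UU>(N\<^sub>G(S))\<close>, and the terms of the corresponding chain are strongly closed.
\<close>

section \<open>Fixed points, conjugation and Sylow subgroups\<close>

lemma le_card_if_dvd_card: "\<lbrakk>n dvd card A; finite A; x \<in> A\<rbrakk> \<Longrightarrow> n \<le> card A"
  by (metis card_gt_0_iff dvd_imp_le empty_iff)

text \<open>Only the identity and product laws are demanded: bijectivity follows because
  \<open>f (inv g)\<close> inverts \<open>f g\<close>. The restriction to \<open>E\<close> is there
  because elements of \<open>BijGroup E\<close> are extensional functions.\<close>

lemma group_actionI:
  assumes "group P"
    and "\<And>g x. \<lbrakk>g \<in> carrier P; x \<in> E\<rbrakk> \<Longrightarrow> f g x \<in> E"
    and "\<And>x. x \<in> E \<Longrightarrow> f \<one>\<^bsub>P\<^esub> x = x"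
    and "\<And>g h x. \<lbrakk>g \<in> carrier P; h \<in> carrier P; x \<in> E\<rbrakk> \<Longrightarrow> f (g \<otimes>\<^bsub>P\<^esub> h) x = f g (f h x)"
  shows "group_action P E (\<lambda>g. \<lambda>x\<in>E. f g x)"
proof -
  interpret group P by fact
  have bij: "bij_betw (f g) E E" if "g \<in> carrier P" for g
  proof (rule bij_betwI[where g = "f (inv\<^bsub>P\<^esub> g)"])
    show "f (inv\<^bsub>P\<^esub> g) (f g x) = x" if "x \<in> E" for x
      using assms(3)[OF \<open>x \<in> E\<close>] assms(4)[of "inv\<^bsub>P\<^esub> g" g x] that \<open>g \<in> carrier P\<close> by simp
    show "f g (f (inv\<^bsub>P\<^esub> g) x) = x" if "x \<in> E" for x
      using assms(3)[OF \<open>x \<in> E\<close>] assms(4)[of g "inv\<^bsub>P\<^esub> g" x] that \<open>g \<in> carrier P\<close> by simp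
  qed (use assms that in auto)
  have "(\<lambda>g. \<lambda>x\<in>E. f g x) \<in> hom P (BijGroup E)"
  proof (rule homI)
    show "(\<lambda>x\<in>E. f g x) \<in> carrier (BijGroup E)" if "g \<in> carrier P" for g
      using bij[OF that] by (simp add: BijGroup_def Bij_def)
    show "(\<lambda>x\<in>E. f (g \<otimes>\<^bsub>P\<^esub> h) x) = (\<lambda>x\<in>E. f g x) \<otimes>\<^bsub>BijGroup E\<^esub> (\<lambda>x\<in>E. f h x)"
      if "g \<in> carrier P" "h \<in> carrier P" for g h
      using bij[of g] bij[of h] that assms(2,4)
      by (auto simp: BijGroup_def Bij_def compose_def fun_eq_iff)
  qed
  then show ?thesis
    by (simp add: group_action_def group_hom_def group_hom_axioms_def group_BijGroup is_group)
qed

text \<open>The comparison is made orbit by orbit modulo \<open>p\<close>. An orbit meeting the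
  fixed points is a single point; any other orbit has length \<open>p ^ j\<close> with
  \<open>j\<close> nonzero by the orbit-stabilizer theorem, so it contributes 0 modulo
  \<open>p\<close> to both counts.\<close>

lemma (in group_action) prime_dvd_card_fixed_points_iff:
  assumes "finite E" "Factorial_Ring.prime p" "order G = p ^ k"
  shows "p dvd card {x \<in> E. \<forall>g\<in>carrier G. \<phi> g x = x} \<longleftrightarrow> p dvd card E"
proof -
  let ?F = "{x \<in> E. \<forall>g\<in>carrier G. \<phi> g x = x}"
  have orb_eq: "(\<Sum>x\<in>orb. if x \<in> ?F then 1 else 0) mod p = (\<Sum>x\<in>orb. 1::nat) mod p"
    if orb: "orb \<in> orbits G E \<phi>" for orb
  proof (cases "orb \<inter> ?F = {}")
    case False
    then obtain x where x: "x \<in> orb" "x \<in> ?F" by blast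
    obtain y where y: "y \<in> E" "orb = orbit G \<phi> y" using orb by (auto simp: orbits_def)
    have "y \<in> orbit G \<phi> x" using orbit_sym[of y x] x y by blast
    then have "y = x" using x by (auto simp: orbit_def)
    have one: "\<one> \<in> carrier G" using group_hom group_hom.axioms(1) group.is_monoid monoid.one_closed by blast
    have "orb = {x}" using x y \<open>y = x\<close> one by (auto simp: orbit_def)
    then show ?thesis using x by simp
  next
    case True
    obtain x where x: "x \<in> E" "orb = orbit G \<phi> x" using orb by (auto simp: orbits_def)
    have sub: "orb \<subseteq> E" using orb orbits_coverture by blast
    have "card orb * card (stabilizer G \<phi> x) = p ^ k"
      using orbit_stabilizer_theorem[OF x(1)] assms(3) x by simp
    then obtain j where j: "card orb = p ^ j"
      using assms(2) by (metis divides_primepow_nat dvd_triv_left)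
    have "j \<noteq> 0"
    proof
      assume "j = 0"
      then obtain z where "orb = {z}" using j by (metis card_1_singletonE power_0)
      moreover have "x \<in> orb" using orbit_refl x by blast
      ultimately have "orb = {x}" by auto
      then have "\<forall>g\<in>carrier G. \<phi> g x = x" using x by (auto simp: orbit_def)
      then show False using True x \<open>orb = {x}\<close> by blast
    qed
    then have "p dvd card orb" using j by simp
    moreover have "(\<Sum>x\<in>orb. if x \<in> ?F then 1 else 0::nat) = 0"
      using True by (intro sum.neutral) auto
    ultimately show ?thesis by simp
  qed
  have "(\<Sum>orb\<in>orbits G E \<phi>. (\<Sum>x\<in>orb. if x \<in> ?F then 1 else 0) mod p) mod p =
      (\<Sum>orb\<in>orbits G E \<phi>. (\<Sum>x\<in>orb. 1::nat) mod p) mod p"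
    by (intro arg_cong[where f = "\<lambda>n. n mod p"] sum.cong refl orb_eq)
  then have "(\<Sum>orb\<in>orbits G E \<phi>. \<Sum>x\<in>orb. if x \<in> ?F then 1 else 0) mod p =
      (\<Sum>orb\<in>orbits G E \<phi>. \<Sum>x\<in>orb. 1::nat) mod p"
    unfolding mod_sum_eq .
  then have "(\<Sum>x\<in>E. if x \<in> ?F then 1 else 0) mod p = (\<Sum>x\<in>E. 1::nat) mod p"
    unfolding disjoint_sum[OF assms(1)] .
  moreover have "(\<Sum>x\<in>E. if x \<in> ?F then 1 else 0::nat) = card ?F"
    using assms(1) by (simp add: sum.If_cases Int_def)
  ultimately show ?thesis by (simp add: dvd_eq_mod_eq_0)
qed

context group
begin

text \<open>The same count with the action given by a plain function. The product law is that of a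
  left action, so conjugation and right multiplication enter later through inverses.\<close>

lemma prime_dvd_fixed_points_iff:
  assumes "subgroup P G" "card P = p ^ k" "Factorial_Ring.prime p" "finite E"
    and "\<And>g x. \<lbrakk>g \<in> P; x \<in> E\<rbrakk> \<Longrightarrow> f g x \<in> E"
    and "\<And>x. x \<in> E \<Longrightarrow> f \<one> x = x"
    and "\<And>g h x. \<lbrakk>g \<in> P; h \<in> P; x \<in> E\<rbrakk> \<Longrightarrow> f (g \<otimes> h) x = f g (f h x)"
  shows "p dvd card {x \<in> E. \<forall>g\<in>P. f g x = x} \<longleftrightarrow> p dvd card E"
proof -
  have "group_action (G\<lparr>carrier := P\<rparr>) E (\<lambda>g. \<lambda>x\<in>E. f g x)"
    using assms by (intro group_actionI subgroup_imp_group) auto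
  from group_action.prime_dvd_card_fixed_points_iff[OF this assms(4,3), of k] assms(2)
  show ?thesis by (simp add: order_def cong: conj_cong)
qed

end

section \<open>Conjugation from the right\<close>

definition conj_by :: "('a, 'b) monoid_scheme \<Rightarrow> 'a \<Rightarrow> 'a \<Rightarrow> 'a" where
  "conj_by G g x = inv\<^bsub>G\<^esub> g \<otimes>\<^bsub>G\<^esub> x \<otimes>\<^bsub>G\<^esub> g"

context group
begin

lemma conj_by_closed [simp]: "\<lbrakk>g \<in> carrier G; x \<in> carrier G\<rbrakk> \<Longrightarrow> conj_by G g x \<in> carrier G"
  by (simp add: conj_by_def)

lemma conj_by_one [simp]: "x \<in> carrier G \<Longrightarrow> conj_by G \<one> x = x"
  by (simp add: conj_by_def)

text \<open>The convention is that of the morphisms of \<open>group_fusion_system\<close>, which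
  makes conjugation a right action; hence the reversed order.\<close>

lemma conj_by_mult:
  "\<lbrakk>g \<in> carrier G; h \<in> carrier G; x \<in> carrier G\<rbrakk> \<Longrightarrow> conj_by G (g \<otimes> h) x = conj_by G h (conj_by G g x)"
  by (simp add: conj_by_def inv_mult_group m_assoc)

lemma conj_by_distrib:
  "\<lbrakk>g \<in> carrier G; x \<in> carrier G; y \<in> carrier G\<rbrakk> \<Longrightarrow> conj_by G g (x \<otimes> y) = conj_by G g x \<otimes> conj_by G g y"
  by (simp add: conj_by_def m_assoc) (metis inv_closed l_inv_ex l_one m_assoc m_closed r_inv)

lemma conj_by_inv:
  "\<lbrakk>g \<in> carrier G; x \<in> carrier G\<rbrakk> \<Longrightarrow> conj_by G g (inv x) = inv (conj_by G g x)"
  by (simp add: conj_by_def inv_mult_group m_assoc)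

lemma conj_by_inv_cancel [simp]:
  "\<lbrakk>g \<in> carrier G; x \<in> carrier G\<rbrakk> \<Longrightarrow> conj_by G (inv g) (conj_by G g x) = x"
  "\<lbrakk>g \<in> carrier G; x \<in> carrier G\<rbrakk> \<Longrightarrow> conj_by G g (conj_by G (inv g) x) = x"
  by (simp_all flip: conj_by_mult)

lemma inj_on_conj_by: "g \<in> carrier G \<Longrightarrow> inj_on (conj_by G g) (carrier G)"
  by (metis conj_by_inv_cancel(1) inj_onI)

lemma card_conj_by_image:
  "\<lbrakk>g \<in> carrier G; A \<subseteq> carrier G\<rbrakk> \<Longrightarrow> card (conj_by G g ` A) = card A"
  by (meson card_image inj_on_conj_by inj_on_subset)

text \<open>Conjugation is injective, so for a finite set an inclusion of the image is already an
  equality.\<close>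

lemma conj_by_image_eqI:
  "\<lbrakk>g \<in> carrier G; A \<subseteq> carrier G; finite A; conj_by G g ` A \<subseteq> A\<rbrakk> \<Longrightarrow> conj_by G g ` A = A"
  by (simp add: card_conj_by_image card_subset_eq)

lemma subgroup_conj_by_image:
  assumes "g \<in> carrier G" "subgroup A G"
  shows "subgroup (conj_by G g ` A) G"
proof (rule subgroupI)
  note A = subgroup.subset[OF assms(2)]
  show "conj_by G g ` A \<subseteq> carrier G" using assms A by auto
  show "conj_by G g ` A \<noteq> {}" using subgroup.one_closed[OF assms(2)] by blast
  show "inv a \<in> conj_by G g ` A" if "a \<in> conj_by G g ` A" for a
  proof -
    obtain x where x: "x \<in> A" "a = conj_by G g x" using \<open>a \<in> conj_by G g ` A\<close> by blast
    then have "inv a = conj_by G g (inv x)" using assms A by (auto simp: conj_by_inv)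
    then show ?thesis using x assms by (simp add: subgroup.m_inv_closed)
  qed
  show "a \<otimes> b \<in> conj_by G g ` A" if ab: "a \<in> conj_by G g ` A" "b \<in> conj_by G g ` A" for a b
  proof -
    obtain x y where x: "x \<in> A" "a = conj_by G g x" "y \<in> A" "b = conj_by G g y" using ab by blast
    then have "a \<otimes> b = conj_by G g (x \<otimes> y)" using assms A by (simp add: conj_by_distrib subset_iff)
    then show ?thesis using x assms by (simp add: subgroup.m_closed)
  qed
qed

lemma conj_by_subgroup:
  assumes "subgroup H G" "g \<in> H"
  shows "conj_by (G\<lparr>carrier := H\<rparr>) g x = conj_by G g x"
  using assms by (simp add: conj_by_def)

lemma normal_iff_conj_by:
  "N \<lhd> G \<longleftrightarrow> subgroup N G \<and> (\<forall>g\<in>carrier G. \<forall>x\<in>N. conj_by G g x \<in> N)"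
  unfolding normal_inv_iff conj_by_def by (metis inv_closed inv_inv)

section \<open>Fixed points on right cosets\<close>

lemma rcoset_fixed_iff:
  assumes "subgroup H G" "g \<in> carrier G" "a \<in> carrier G"
  shows "H #> g #> inv a = H #> g \<longleftrightarrow> conj_by G (inv g) a \<in> H"
proof -
  have H: "H \<subseteq> carrier G" using assms(1) by (rule subgroup.subset)
  have eq: "H #> g #> inv a = H #> (g \<otimes> inv a)" using assms H by (simp add: coset_mult_assoc)
  have "H #> (g \<otimes> inv a) = H #> g \<longleftrightarrow> g \<otimes> inv a \<in> H #> g"
    using assms H by (metis inv_closed m_closed rcos_self repr_independence)
  also have "\<dots> \<longleftrightarrow> g \<otimes> inv a \<otimes> inv g \<in> H"
    using assms by (simp add: subgroup.rcos_module is_group)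
  also have "\<dots> \<longleftrightarrow> inv (g \<otimes> inv a \<otimes> inv g) \<in> H"
    using assms by (metis inv_closed inv_inv m_closed subgroup.m_inv_closed)
  also have "inv (g \<otimes> inv a \<otimes> inv g) = conj_by G (inv g) a"
    using assms by (simp add: conj_by_def inv_mult_group m_assoc)
  finally show ?thesis using eq by simp
qed

lemma prime_dvd_card_fixed_rcosets_iff:
  assumes "subgroup P G" "card P = p ^ k" "Factorial_Ring.prime p" "subgroup H G" "finite (carrier G)"
  shows "p dvd card {Y. Y \<in> rcosets H \<and> (\<forall>a\<in>P. Y #> inv a = Y)} \<longleftrightarrow> p dvd card (rcosets H)"
proof (rule prime_dvd_fixed_points_iff[OF assms(1-3)])
  note P = subgroup.mem_carrier[OF assms(1)]
  have H: "H \<subseteq> carrier G" using assms(4) by (rule subgroup.subset)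
  show "finite (rcosets H)" using assms(5) H by (simp add: RCOSETS_def)
  fix Y assume "Y \<in> rcosets H"
  then obtain g where g: "g \<in> carrier G" "Y = H #> g" by (auto simp: RCOSETS_def)
  show "Y #> inv \<one> = Y" using g H by (simp add: coset_mult_assoc)
  show "Y #> inv a \<in> rcosets H" if "a \<in> P" for a
    using g P[OF that] H by (simp add: coset_mult_assoc rcosetsI)
  show "Y #> inv (a \<otimes> b) = Y #> inv b #> inv a" if "a \<in> P" "b \<in> P" for a b
    using g P[OF that(1)] P[OF that(2)] H by (simp add: coset_mult_assoc inv_mult_group m_assoc)
qed

text \<open>\<open>P\<close> acts on the right cosets of \<open>H\<close>, whose number is prime to
  \<open>p\<close>, so some coset \<open>H #> g\<close> is fixed. Its stabilizer is a conjugate of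
  \<open>H\<close>, hence \<open>inv g\<close> conjugates \<open>P\<close> into
  \<open>H\<close>.\<close>

lemma sylow_contains_conjugate:
  assumes "subgroup P G" "card P = p ^ k" "Factorial_Ring.prime p" "subgroup H G" "finite (carrier G)"
    and "\<not> p dvd card (rcosets H)"
  shows "\<exists>g\<in>carrier G. conj_by G g ` P \<subseteq> H"
proof -
  have "{Y. Y \<in> rcosets H \<and> (\<forall>a\<in>P. Y #> inv a = Y)} \<noteq> {}"
    using prime_dvd_card_fixed_rcosets_iff[OF assms(1-5)] assms(6) by (metis card.empty dvd_0_right)
  then obtain g where g: "g \<in> carrier G" "\<forall>a\<in>P. H #> g #> inv a = H #> g"
    by (auto simp: RCOSETS_def)
  then have "conj_by G (inv g) ` P \<subseteq> H"
    using rcoset_fixed_iff[OF assms(4)] subgroup.mem_carrier[OF assms(1)] by blast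
  then show ?thesis using g inv_closed by blast
qed

text \<open>Let \<open>A\<close> act on its own right cosets. Their number is \<open>p ^ i\<close>
  with \<open>i\<close> nonzero, so the number of fixed cosets is a multiple of \<open>p\<close>.
  The coset \<open>A\<close> is one of them, and for any other fixed coset \<open>A #> g\<close> the
  element \<open>inv g\<close> normalizes \<open>A\<close>.\<close>

lemma p_group_normalizer_grows:
  assumes "finite (carrier G)" "order G = p ^ n" "Factorial_Ring.prime p" "subgroup A G" "A \<noteq> carrier G"
  shows "\<exists>g\<in>carrier G - A. conj_by G g ` A = A"
proof -
  note A = subgroup.subset[OF assms(4)]
  let ?F = "{Y. Y \<in> rcosets A \<and> (\<forall>a\<in>A. Y #> inv a = Y)}"
  have lag: "card (rcosets A) * card A = p ^ n"
    using lagrange[OF assms(4)] assms(2) by simp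
  then obtain j where j: "card A = p ^ j" using assms(3) by (metis divides_primepow_nat dvd_triv_right)
  obtain i where i: "card (rcosets A) = p ^ i" using lag assms(3) by (metis divides_primepow_nat dvd_triv_left)
  have "i \<noteq> 0"
  proof
    assume "i = 0"
    then have "card A = card (carrier G)" using lag i assms(2) by (simp add: order_def)
    then show False using A assms by (metis card_subset_eq)
  qed
  then have "p dvd card ?F"
    using i prime_dvd_card_fixed_rcosets_iff[OF assms(4) j assms(3,4,1)] by simp
  moreover have fin: "finite ?F" using assms(1) A by (simp add: RCOSETS_def)
  moreover have AF: "A \<in> ?F"
  proof -
    have "A #> inv a = A" if "a \<in> A" for a
      using that assms(4) A by (simp add: coset_join2 subgroup.m_inv_closed subset_iff)
    moreover have "A \<in> rcosets A" using assms(4) by (simp add: subgroup.subgroup_in_rcosets is_group)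
    ultimately show ?thesis by blast
  qed
  ultimately have "p \<le> card ?F" by (rule le_card_if_dvd_card)
  then have "card ?F \<ge> 2" using prime_ge_2_nat[OF assms(3)] by linarith
  then have "?F \<noteq> {A}" by auto
  then obtain Y where Y: "Y \<in> ?F" "Y \<noteq> A" using AF by blast
  then obtain g where g: "g \<in> carrier G" "Y = A #> g" by (auto simp: RCOSETS_def)
  have "g \<notin> A" using g Y assms(4) by (auto simp: coset_join2)
  moreover have "conj_by G (inv g) ` A \<subseteq> A"
    using Y g rcoset_fixed_iff[OF assms(4)] A by blast
  ultimately have "conj_by G (inv g) ` A = A"
    using g assms A by (intro conj_by_image_eqI) (auto dest: finite_subset)
  moreover have "inv g \<in> carrier G - A"
    using g \<open>g \<notin> A\<close> assms(4) by (metis DiffI inv_closed inv_inv subgroup.m_inv_closed)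
  ultimately show ?thesis by blast
qed

text \<open>\<open>T\<close> permutes the \<open>p\<close> cosets of \<open>K\<close> in
  \<open>H\<close>. The number of fixed cosets is a multiple of \<open>p\<close> and is positive
  because \<open>K\<close> is fixed, so all cosets are fixed. The conclusion is the commutator form
  of this.\<close>

lemma p_subgroup_centralizes_factor_of_order_p:
  assumes "finite (carrier G)" "Factorial_Ring.prime p" "subgroup T G" "card T = p ^ k"
    and "H \<lhd> G" "K \<lhd> G" "K \<subseteq> H" "card H = p * card K" "t \<in> T" "h \<in> H"
  shows "inv h \<otimes> conj_by G t h \<in> K"
proof -
  have sH: "subgroup H G" and sK: "subgroup K G" using assms by (simp_all add: normal_imp_subgroup)
  note T = subgroup.mem_carrier[OF assms(3)] and H = subgroup.mem_carrier[OF sH]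
    and K = subgroup.subset[OF sK]
  let ?H = "G\<lparr>carrier := H\<rparr>"
  let ?E = "(\<lambda>h. K #> h) ` H"
  have coset: "conj_by G (inv t) ` (K #> h) = K #> conj_by G (inv t) h" if "t \<in> carrier G" "h \<in> carrier G" for t h
  proof -
    have cK: "conj_by G (inv t) ` K = K"
      using assms(1,6) that K by (intro conj_by_image_eqI) (auto simp: normal_iff_conj_by finite_subset)
    have "conj_by G (inv t) ` (K #> h) = (\<lambda>k. conj_by G (inv t) k \<otimes> conj_by G (inv t) h) ` K"
      unfolding r_coset_def using that K by (auto simp: conj_by_distrib subset_iff image_iff)
    also have "\<dots> = (\<lambda>k. k \<otimes> conj_by G (inv t) h) ` (conj_by G (inv t) ` K)"
      by (simp add: image_image)
    finally show ?thesis unfolding cK by (auto simp: r_coset_def)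
  qed
  have finE: "finite ?E" using assms(1) sH by (meson finite_imageI finite_subset subgroup.subset)
  have cardE: "card ?E = p"
  proof -
    have "rcosets\<^bsub>?H\<^esub> K = ?E" by (auto simp: RCOSETS_def r_coset_def)
    then have "card ?E * card K = card H"
      using group.lagrange[OF subgroup_imp_group[OF sH], of K] sH sK assms(7)
      by (simp add: order_def subgroup_incl)
    moreover have "card K > 0"
      using finite_subset[OF K assms(1)] subgroup.one_closed[OF sK] card_gt_0_iff by blast
    ultimately show ?thesis using assms(8) by simp
  qed
  let ?F = "{Y \<in> ?E. \<forall>t\<in>T. conj_by G (inv t) ` Y = Y}"
  have "p dvd card ?F \<longleftrightarrow> p dvd card ?E"
  proof (rule prime_dvd_fixed_points_iff[OF assms(3,4,2) finE])
    fix Y assume "Y \<in> ?E"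
    then obtain h where h: "h \<in> H" "Y = K #> h" by auto
    have Y: "Y \<subseteq> carrier G" using h K H by (auto simp: r_coset_def)
    show "conj_by G (inv \<one>) ` Y = Y" using Y by (auto simp: image_def subset_iff)
    show "conj_by G (inv t) ` Y \<in> ?E" if "t \<in> T" for t
      using h coset[of t h] T[OF that] H[OF h(1)] assms(5) by (auto simp: normal_iff_conj_by)
    show "conj_by G (inv (t \<otimes> u)) ` Y = conj_by G (inv t) ` conj_by G (inv u) ` Y"
      if "t \<in> T" "u \<in> T" for t u
      using Y T[OF that(1)] T[OF that(2)]
      by (auto simp: image_image inv_mult_group conj_by_mult subset_iff intro!: image_cong)
  qed
  then have "p dvd card ?F" using cardE by simp
  moreover have "K \<in> ?F"
  proof -
    have "K \<in> ?E" using sH K by (metis coset_mult_one image_eqI subgroup.one_closed)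
    moreover have "conj_by G (inv t) ` K = K" if "t \<in> T" for t
      using coset[of t \<one>] T[OF that] K by (simp add: conj_by_def)
    ultimately show ?thesis by blast
  qed
  moreover have "finite ?F" using finE by simp
  ultimately have "card ?E \<le> card ?F" unfolding cardE by (intro le_card_if_dvd_card)
  moreover have "?F \<subseteq> ?E" by blast
  ultimately have "?F = ?E" using finE by (meson card_seteq)
  moreover have "K #> h \<in> ?E" using assms(10) by blast
  ultimately have "\<forall>t\<in>T. conj_by G (inv t) ` (K #> h) = K #> h"
    by (metis (mono_tags, lifting) mem_Collect_eq)
  \<comment> \<open>The action was set up with inverses, so the fixed-point statement is applied to
    \<open>inv t\<close> to reach conjugation by \<open>t\<close> itself.\<close>
  then have "conj_by G (inv (inv t)) ` (K #> h) = K #> h"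
    using subgroup.m_inv_closed[OF assms(3,9)] by (rule bspec)
  then have "K #> conj_by G t h = K #> h"
    using coset[of "inv t" h] T[OF assms(9)] H[OF assms(10)] by simp
  then have "conj_by G t h \<in> K #> h"
    using rcos_self[OF _ sK, of "conj_by G t h"] T[OF assms(9)] H[OF assms(10)] by simp
  then obtain k where k: "k \<in> K" "conj_by G t h = k \<otimes> h" by (auto simp: r_coset_def)
  then have "inv h \<otimes> conj_by G t h = conj_by G h k"
    using H[OF assms(10)] K by (auto simp: conj_by_def m_assoc)
  then show ?thesis using k assms(6) H[OF assms(10)] by (simp add: normal_iff_conj_by)
qed

end

text \<open>\<open>Greatest\<close> is a definite description, so existence has to be proved: in a
  finite directed family a maximal member contains all the others.\<close>

lemma Greatest_set_directed:
  assumes "finite {A. P A}" "P A"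
    and "\<And>A B. \<lbrakk>P A; P B\<rbrakk> \<Longrightarrow> \<exists>C. P C \<and> A \<subseteq> C \<and> B \<subseteq> C"
  shows "P (Greatest P)" "P B \<Longrightarrow> B \<subseteq> Greatest P"
proof -
  obtain M where M: "P M" "\<And>B. P B \<Longrightarrow> M \<subseteq> B \<Longrightarrow> B = M"
    using finite_has_maximal[of "{A. P A}"] assms(1,2) by blast
  have top: "B \<subseteq> M" if "P B" for B using assms(3)[OF M(1) that] M(2) by blast
  then have "Greatest P = M" using M(1) by (intro Greatest_equality)
  then show "P (Greatest P)" "P B \<Longrightarrow> B \<subseteq> Greatest P" using M(1) top by simp_all
qed

section \<open>Orders of products of subgroups\<close>

context group
begin

lemma card_subgroup_dvd:
  assumes "subgroup H G" "subgroup K G" "H \<subseteq> K"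
  shows "card H dvd card K"
proof -
  have "subgroup H (G\<lparr>carrier := K\<rparr>)" using assms by (rule subgroup_incl)
  from group.lagrange[OF subgroup_imp_group[OF assms(2)] this]
  have "card K = card (rcosets\<^bsub>G\<lparr>carrier := K\<rparr>\<^esub> H) * card H" by (simp add: order_def)
  then show ?thesis by (rule dvdI[OF trans]) (rule mult.commute)
qed

text \<open>Every fibre of the multiplication map from pairs onto \<open>H <#> K\<close> has as many
  elements as \<open>H \<inter> K\<close>.\<close>

lemma card_set_mult:
  assumes "finite (carrier G)" "subgroup H G" "subgroup K G"
  shows "card (H <#> K) * card (H \<inter> K) = card H * card K"
proof -
  have fin: "finite H" "finite K"
    using assms by (auto intro: finite_subset[OF subgroup.subset])
  let ?m = "\<lambda>(h, k). h \<otimes> k"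
  have fiber: "card {z \<in> H \<times> K. ?m z = y} = card (H \<inter> K)" if y: "y \<in> H <#> K" for y
  proof -
    obtain h k where hk: "h \<in> H" "k \<in> K" "y = h \<otimes> k" using y by (auto simp: set_mult_def)
    note mem = subgroup.mem_carrier[OF assms(2)] subgroup.mem_carrier[OF assms(3)]
    \<comment> \<open>The factorizations of \<open>h \<otimes> k\<close> arise by shifting an
      element \<open>u\<close> of the intersection from one factor to the other.\<close>
    have "bij_betw (\<lambda>u. (h \<otimes> u, inv u \<otimes> k)) (H \<inter> K) {z \<in> H \<times> K. ?m z = y}"
    proof (rule bij_betwI[where g = "\<lambda>z. inv h \<otimes> fst z"])
      show "(\<lambda>u. (h \<otimes> u, inv u \<otimes> k)) \<in> H \<inter> K \<rightarrow> {z \<in> H \<times> K. ?m z = y}"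
      proof
        fix u assume u: "u \<in> H \<inter> K"
        then have "h \<otimes> u \<otimes> (inv u \<otimes> k) = h \<otimes> (u \<otimes> inv u) \<otimes> k"
          using u hk mem(1)[of u] mem(1)[of h] mem(2)[of k] by (simp only: m_assoc m_closed inv_closed IntD1)
        also have "\<dots> = y" using u hk mem by auto
        finally show "(h \<otimes> u, inv u \<otimes> k) \<in> {z \<in> H \<times> K. ?m z = y}"
          using u hk assms by (auto intro: subgroup.m_closed subgroup.m_inv_closed)
      qed
      show "(\<lambda>z. inv h \<otimes> fst z) \<in> {z \<in> H \<times> K. ?m z = y} \<rightarrow> H \<inter> K"
      proof
        fix z assume "z \<in> {z \<in> H \<times> K. ?m z = y}"
        then obtain a b where z: "z = (a, b)" "a \<in> H" "b \<in> K" "a \<otimes> b = h \<otimes> k" using hk by auto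
        have c: "a \<in> carrier G" "b \<in> carrier G" "h \<in> carrier G" "k \<in> carrier G"
          using z hk mem by auto
        have "inv h \<otimes> a = inv h \<otimes> (a \<otimes> b) \<otimes> inv b" using c by (simp add: m_assoc)
        also have "\<dots> = k \<otimes> inv b" unfolding z(4) using c by (simp add: m_assoc[symmetric])
        finally have "inv h \<otimes> a = k \<otimes> inv b" .
        moreover have "inv h \<otimes> a \<in> H" "k \<otimes> inv b \<in> K"
          using z hk assms by (auto intro: subgroup.m_closed subgroup.m_inv_closed)
        ultimately show "inv h \<otimes> fst z \<in> H \<inter> K" using z by simp
      qed
      show "inv h \<otimes> fst (h \<otimes> u, inv u \<otimes> k) = u" if "u \<in> H \<inter> K" for u
        using that hk mem by (simp add: m_assoc[symmetric])
      show "(h \<otimes> (inv h \<otimes> fst z), inv (inv h \<otimes> fst z) \<otimes> k) = z"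
        if zy: "z \<in> {z \<in> H \<times> K. ?m z = y}" for z
      proof -
        obtain a b where z: "z = (a, b)" "a \<in> H" "b \<in> K" "a \<otimes> b = h \<otimes> k" using zy hk by auto
        have c: "a \<in> carrier G" "b \<in> carrier G" "h \<in> carrier G" "k \<in> carrier G"
          using z hk mem by auto
        have "inv (inv h \<otimes> a) \<otimes> k = inv a \<otimes> (h \<otimes> k)"
          using c by (simp add: inv_mult_group m_assoc)
        also have "\<dots> = b" using c by (simp add: z(4)[symmetric] m_assoc[symmetric])
        finally show ?thesis using z c by (simp add: m_assoc[symmetric])
      qed
    qed
    then show ?thesis by (simp add: bij_betw_same_card)
  qed
  have "H <#> K = ?m ` (H \<times> K)" by (force simp: set_mult_def)
  then have "card (H \<times> K) = (\<Sum>y\<in>H <#> K. card {z \<in> H \<times> K. ?m z = y})"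
    using sum.image_gen[of "H \<times> K" "\<lambda>_. 1::nat" ?m] fin by simp
  also have "\<dots> = card (H <#> K) * card (H \<inter> K)" using fiber by simp
  finally show ?thesis by (simp add: card_cartesian_product)
qed

lemma set_mult_upper:
  assumes "subgroup H G" "subgroup K G"
  shows "H \<subseteq> H <#> K" "K \<subseteq> H <#> K"
proof -
  have "h \<otimes> \<one> \<in> H <#> K" if "h \<in> H" for h
    using that subgroup.one_closed[OF assms(2)] unfolding set_mult_def by blast
  then show "H \<subseteq> H <#> K" using subgroup.mem_carrier[OF assms(1)] by auto
  have "\<one> \<otimes> k \<in> H <#> K" if "k \<in> K" for k
    using that subgroup.one_closed[OF assms(1)] unfolding set_mult_def by blast
  then show "K \<subseteq> H <#> K" using subgroup.mem_carrier[OF assms(2)] by auto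
qed

lemma one_set_mult: "K \<subseteq> carrier G \<Longrightarrow> {\<one>} <#> K = K"
  by (auto simp: set_mult_def) (metis l_one subsetD)

lemma normal_set_mult:
  assumes "H \<lhd> G" "K \<lhd> G"
  shows "H <#> K \<lhd> G"
  unfolding normal_iff_conj_by
proof (intro conjI ballI)
  show "subgroup (H <#> K) G" using assms by (simp add: mult_norm_subgroup normal_imp_subgroup)
  fix g x assume g: "g \<in> carrier G" and "x \<in> H <#> K"
  then obtain h k where hk: "h \<in> H" "k \<in> K" "x = h \<otimes> k" by (auto simp: set_mult_def)
  then have "conj_by G g x = conj_by G g h \<otimes> conj_by G g k"
    using g assms by (meson conj_by_distrib normal_imp_subgroup subgroup.mem_carrier)
  then show "conj_by G g x \<in> H <#> K"
    using g hk assms unfolding set_mult_def normal_iff_conj_by by blast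
qed

text \<open>The product formula for \<open>K\<close> and for \<open>K'\<close>, divided by one
  another, splits the index \<open>q\<close> into an index of products and an index of
  intersections. Normality of \<open>L\<close> makes the products subgroups, so both indices are
  integers. For prime \<open>q\<close> each of them is 1 or \<open>q\<close>.\<close>

lemma index_set_mult_Int:
  assumes "finite (carrier G)" "subgroup K G" "subgroup K' G" "L \<lhd> G" "K' \<subseteq> K" "card K = q * card K'"
  obtains m n where "m * n = q" "card (K <#> L) = m * card (K' <#> L)" "card (K \<inter> L) = n * card (K' \<inter> L)"
proof -
  have L: "subgroup L G" using assms(4) by (rule normal_imp_subgroup)
  have KL: "subgroup (K <#> L) G" "subgroup (K' <#> L) G"
    using mult_norm_subgroup[OF assms(4,2)] mult_norm_subgroup[OF assms(4,3)]
      commut_normal[OF assms(2,4)] commut_normal[OF assms(3,4)] by simp_all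
  have "card (K' <#> L) dvd card (K <#> L)"
    using KL assms(5) by (intro card_subgroup_dvd) (auto simp: set_mult_def)
  then obtain m where m: "card (K <#> L) = m * card (K' <#> L)" by (auto simp: dvd_def mult.commute)
  have "card (K' \<inter> L) dvd card (K \<inter> L)"
    using L assms by (intro card_subgroup_dvd subgroups_Inter_pair) auto
  then obtain n where n: "card (K \<inter> L) = n * card (K' \<inter> L)" by (auto simp: dvd_def mult.commute)
  have "m * n * (card (K' <#> L) * card (K' \<inter> L)) = q * (card (K' <#> L) * card (K' \<inter> L))"
    using card_set_mult[OF assms(1,2) L] card_set_mult[OF assms(1,3) L] m n assms(6)
    by (simp add: ac_simps)
  moreover have "card (K' <#> L) * card (K' \<inter> L) \<noteq> 0"
  proof -
    have "card K' \<noteq> 0" "card L \<noteq> 0"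
      using subgroup.finite_imp_card_positive[OF _ assms(1)] assms(3) L by auto
    then show ?thesis using card_set_mult[OF assms(1,3) L] by simp
  qed
  ultimately have "m * n = q" by simp
  then show thesis using that m n by blast
qed

end

section \<open>The supersolvable hypercenter\<close>

text \<open>A series of normal subgroups of \<open>G\<close> from 1 up to the given subgroup, with
  prime indices that may differ from step to step. For finite groups this is the condition in
  \<open>supersolvable_hypercenter\<close>, by \<open>hypercentral_iff_prime_chain\<close>, in a
  form suited to induction and counting instead of chief factors and quotients.\<close>

inductive prime_chain :: "('a, 'b) monoid_scheme \<Rightarrow> 'a set \<Rightarrow> bool" for G where
  trivial: "prime_chain G {\<one>\<^bsub>G\<^esub>}"
| step: "\<lbrakk>prime_chain G K; H \<lhd> G; K \<subseteq> H; Factorial_Ring.prime q; card H = q * card K\<rbrakk> \<Longrightarrow> prime_chain G H"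

context group
begin

lemma prime_chain_normal: "prime_chain G N \<Longrightarrow> N \<lhd> G"
  by (induction rule: prime_chain.induct) (auto simp: one_is_normal)

text \<open>The last hypothesis says that \<open>N\<close> covers the factor of \<open>H\<close> by
  \<open>K\<close>. The proof descends the chain of \<open>N\<close>: if the next term
  \<open>N'\<close> still covers the factor, the induction hypothesis applies; otherwise
  \<open>(H \<inter> N') <#> K\<close> has prime index in \<open>H\<close>. The trivial term cannot
  cover, since \<open>K\<close> is proper in \<open>H\<close>.\<close>

lemma prime_chain_refine:
  assumes "finite (carrier G)" "prime_chain G N" "H \<lhd> G" "K \<lhd> G" "K \<subset> H" "(H \<inter> N) <#> K = H"
  shows "\<exists>L q. L \<lhd> G \<and> K \<subseteq> L \<and> L \<subset> H \<and> Factorial_Ring.prime q \<and> card H = q * card L"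
  using assms(2,6)
proof (induction rule: prime_chain.induct)
  case trivial
  have "H \<inter> {\<one>} = {\<one>}" using assms(3) normal_imp_subgroup subgroup.one_closed by blast
  then have "H = K" using trivial one_set_mult[OF subgroup.subset[OF normal_imp_subgroup[OF assms(4)]]] by simp
  then show ?case using assms(5) by blast
next
  case (step N' N q)
  have N: "N \<lhd> G" "N' \<lhd> G" using step prime_chain_normal by auto
  note sub = normal_imp_subgroup[OF N(1)] normal_imp_subgroup[OF N(2)] normal_imp_subgroup[OF assms(3)]
    normal_imp_subgroup[OF assms(4)]
  \<comment> \<open>Intersecting with \<open>H\<close> and then multiplying by \<open>K\<close>
    turns the prime index \<open>q\<close> of \<open>N'\<close> in \<open>N\<close> into the index
    \<open>m'\<close> of \<open>(N' \<inter> H) <#> K\<close> in \<open>H\<close>, a divisor of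
    \<open>q\<close>.\<close>
  obtain m n where mn: "m * n = q" "card (N \<inter> H) = n * card (N' \<inter> H)"
    using index_set_mult_Int[OF assms(1) sub(1,2) assms(3) step(3,5)] by blast
  obtain m' n' where mn': "m' * n' = n" "card ((N \<inter> H) <#> K) = m' * card ((N' \<inter> H) <#> K)"
    using index_set_mult_Int[OF assms(1) subgroups_Inter_pair[OF sub(1,3)]
        subgroups_Inter_pair[OF sub(2,3)] assms(4) Int_mono[OF step(3) order_refl] mn(2)] by blast
  have "m' dvd q" using mn mn' by auto
  then consider "m' = 1" | "m' = q" using step(4) by (auto simp: prime_nat_iff)
  note index_cases = this
  have le: "(H \<inter> N') <#> K \<subseteq> H"
    using step(3,7) by (auto simp: set_mult_def)
  have normal: "(H \<inter> N') <#> K \<lhd> G"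
    using assms N by (intro normal_set_mult normal_subgroup_intersect)
  have fin: "finite H" using assms(1) sub(3) finite_subset subgroup.subset by blast
  have card: "card H = m' * card ((H \<inter> N') <#> K)" using mn'(2) step(7) by (simp add: Int_commute)
  have ge: "K \<subseteq> (H \<inter> N') <#> K"
    using sub by (intro set_mult_upper subgroups_Inter_pair)
  from index_cases show ?case
  proof cases
    case 1
    then have "(H \<inter> N') <#> K = H" using le card fin by (simp add: card_subset_eq)
    then show ?thesis by (rule step.IH)
  next
    case 2
    have "card H \<noteq> 0" using fin assms(5) by auto
    have "(H \<inter> N') <#> K \<noteq> H"
    proof
      assume "(H \<inter> N') <#> K = H"
      then have "q = 1" using card 2 \<open>card H \<noteq> 0\<close> by simp
      then show False using step(4) by simp
    qed
    then show ?thesis using normal le ge card 2 step(4) by blast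
  qed
qed

text \<open>Multiplying the chain of \<open>M\<close> by \<open>N\<close>, each step either
  collapses or keeps its prime index.\<close>

lemma prime_chain_set_mult:
  assumes "finite (carrier G)" "prime_chain G N" "prime_chain G M"
  shows "prime_chain G (M <#> N)"
  using assms(3)
proof (induction rule: prime_chain.induct)
  case trivial
  show ?case
    using assms(2) prime_chain_normal[OF assms(2)] by (simp add: one_set_mult normal_imp_subgroup subgroup.subset)
next
  case (step M' M q)
  have nor: "M \<lhd> G" "M' \<lhd> G" "N \<lhd> G" using step assms(2) prime_chain_normal by auto
  obtain m n where mn: "m * n = q" "card (M <#> N) = m * card (M' <#> N)"
    using index_set_mult_Int[OF assms(1) normal_imp_subgroup[OF nor(1)] normal_imp_subgroup[OF nor(2)]
        nor(3) step(3,5)] by blast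
  have sub: "M' <#> N \<subseteq> M <#> N" using step(3) by (auto simp: set_mult_def)
  have "m dvd q" using mn by auto
  then consider "m = 1" | "m = q" using step(4) by (auto simp: prime_nat_iff)
  then show ?case
  proof cases
    case 1
    have "finite (M <#> N)"
      using finite_subset[OF subgroup.subset[OF normal_imp_subgroup[OF normal_set_mult[OF nor(1,3)]]] assms(1)] .
    then have "M' <#> N = M <#> N" using 1 mn(2) sub by (simp add: card_subset_eq)
    then show ?thesis using step.IH by simp
  next
    case 2
    then show ?thesis
      using prime_chain.step[OF step.IH normal_set_mult[OF nor(1,3)] sub step(4)] mn(2) by simp
  qed
qed

lemma prime_order_imp_cyclic:
  assumes "Factorial_Ring.prime (order G)"
  shows "cyclic_group G"
proof -
  have "carrier G \<noteq> {\<one>}" using assms by (auto simp: order_def)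
  then obtain x where x: "x \<in> carrier G" "x \<noteq> \<one>" by blast
  have sub: "subgroup (generate G {x}) G" using x by (intro generate_is_subgroup) auto
  have fin: "finite (carrier G)" using assms by (metis card.infinite order_def not_prime_0)
  have "card (generate G {x}) dvd order G" using lagrange[OF sub] by (metis dvd_triv_right)
  then have "card (generate G {x}) = 1 \<or> card (generate G {x}) = order G"
    using assms by (auto simp: prime_nat_iff)
  moreover have "{\<one>, x} \<subseteq> generate G {x}" by (auto intro: generate.intros)
  then have "card (generate G {x}) \<noteq> 1" using x(2) by (auto simp: card_1_singleton_iff)
  ultimately have "generate G {x} = carrier G"
    using sub fin by (metis card_subset_eq order_def subgroup.subset)
  then have "subgroup_generated G {x} = G" using x by (simp add: subgroup_generated_def Int_absorb1)
  then show ?thesis using x by (auto simp: cyclic_group_def)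
qed

lemma card_Mod:
  assumes "subgroup H G" "K \<lhd> G" "K \<subseteq> H"
  shows "group (G\<lparr>carrier := H\<rparr> Mod K)" "order (G\<lparr>carrier := H\<rparr> Mod K) * card K = card H"
proof -
  interpret H: group "G\<lparr>carrier := H\<rparr>" using assms(1) by (rule subgroup_imp_group)
  have K: "K \<lhd> G\<lparr>carrier := H\<rparr>" using assms by (simp add: normal_restrict_supergroup)
  show "group (G\<lparr>carrier := H\<rparr> Mod K)" using K by (rule normal.factorgroup_is_group)
  show "order (G\<lparr>carrier := H\<rparr> Mod K) * card K = card H"
    using H.lagrange[OF normal_imp_subgroup[OF K]] by (simp add: order_def FactGroup_def)
qed

end

section \<open>Prime chains and chief factors\<close>

context
  fixes G :: "'a monoid" (structure)
  assumes group: "group G"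
begin

interpretation group G by (rule group)

text \<open>As \<open>H\<close> lies in \<open>N\<close>, the chief factor is covered by
  \<open>N\<close>. Refinement gives a normal \<open>L\<close> of prime index in \<open>H\<close>
  that contains \<open>K\<close>, and minimality forces \<open>L = K\<close>.\<close>

lemma prime_chain_chief_factor:
  assumes "finite (carrier G)" "prime_chain G N" "chief_factor G H K" "H \<subseteq> N"
  obtains q where "Factorial_Ring.prime q" "card H = q * card K"
proof -
  have c: "H \<lhd> G" "K \<lhd> G" "K \<subset> H" "\<And>L. \<lbrakk>L \<lhd> G; K \<subseteq> L; L \<subseteq> H\<rbrakk> \<Longrightarrow> L = K \<or> L = H"
    using assms(3) by (auto simp: chief_factor_def)
  have "H <#> K \<subseteq> H"
    using c(3) subgroup.m_closed[OF normal_imp_subgroup[OF c(1)]] by (auto simp: set_mult_def)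
  moreover have "H \<subseteq> H <#> K" using c by (intro set_mult_upper normal_imp_subgroup)
  ultimately have "(H \<inter> N) <#> K = H" using assms(4) by (simp add: Int_absorb2)
  from prime_chain_refine[OF assms(1,2) c(1-3) this] c(4) that show ?thesis by blast
qed

text \<open>Induction on \<open>card N\<close>: a chief factor is split off at the top by choosing
  \<open>K\<close> maximal among the normal subgroups of \<open>G\<close> properly inside
  \<open>N\<close>.\<close>

lemma prime_chainI:
  assumes "finite (carrier G)" "N \<lhd> G"
    and "\<And>H K. \<lbrakk>chief_factor G H K; H \<subseteq> N\<rbrakk> \<Longrightarrow> \<exists>q. Factorial_Ring.prime q \<and> card H = q * card K"
  shows "prime_chain G N"
  using assms(2,3)
proof (induction "card N" arbitrary: N rule: less_induct)
  case less
  have fin: "finite N" using finite_subset[OF subgroup.subset[OF normal_imp_subgroup[OF less(2)]] assms(1)] .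
  show ?case
  proof (cases "N = {\<one>}")
    case True
    then show ?thesis by (simp add: prime_chain.trivial)
  next
    case False
    let ?S = "{K. K \<lhd> G \<and> K \<subset> N}"
    have "\<one> \<in> N" using less(2) by (simp add: subgroup.one_closed normal_imp_subgroup)
    then have ne: "?S \<noteq> {}" using False one_is_normal by blast
    have "?S \<subseteq> Pow N" by blast
    then have "finite ?S" by (rule finite_subset) (simp add: fin)
    from finite_has_maximal[OF this ne] obtain K
      where K: "K \<in> ?S" and max: "\<forall>L\<in>?S. K \<subseteq> L \<longrightarrow> K = L" by (elim bexE)
    have chief: "chief_factor G N K"
      unfolding chief_factor_def using K max less(2) by blast
    have pc: "prime_chain G K"
    proof (rule less(1))
      show "card K < card N" using K fin by (simp add: psubset_card_mono)
      show "K \<lhd> G" using K by simp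
      show "\<exists>q. Factorial_Ring.prime q \<and> card H = q * card L" if "chief_factor G H L" "H \<subseteq> K" for H L
        using less(3)[OF that(1)] that(2) K by blast
    qed
    obtain q where q: "Factorial_Ring.prime q" "card N = q * card K"
      using less(3)[OF chief order_refl] by (elim exE conjE)
    have "K \<subseteq> N" using K by blast
    then show ?thesis by (rule prime_chain.step[OF pc less(2) _ q])
  qed
qed

text \<open>The given chain of \<open>N\<close> need not pass through \<open>M\<close>. Chief
  factors below \<open>M\<close> are chief factors below \<open>N\<close>, however, so the
  description by chief factors applies.\<close>

lemma prime_chain_subset:
  assumes "finite (carrier G)" "prime_chain G N" "M \<lhd> G" "M \<subseteq> N"
  shows "prime_chain G M"
proof (rule prime_chainI[OF assms(1,3)])
  fix H K assume c: "chief_factor G H K" "H \<subseteq> M"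
  obtain q where "Factorial_Ring.prime q" "card H = q * card K"
    using prime_chain_chief_factor[OF assms(1,2) c(1) order_trans[OF c(2) assms(4)]] .
  then show "\<exists>q. Factorial_Ring.prime q \<and> card H = q * card K" by blast
qed

text \<open>The left side is the predicate inside \<open>supersolvable_hypercenter\<close>. The
  order of the quotient is the index of \<open>K\<close> in \<open>H\<close>, and cyclicity follows
  from primality, so only indices matter.\<close>

lemma hypercentral_iff_prime_chain:
  assumes "finite (carrier G)"
  shows "(N \<lhd> G \<and> (\<forall>H K. chief_factor G H K \<and> H \<subseteq> N \<longrightarrow>
           cyclic_group (G\<lparr>carrier := H\<rparr> Mod K) \<and> Factorial_Ring.prime (order (G\<lparr>carrier := H\<rparr> Mod K))))
    \<longleftrightarrow> prime_chain G N" (is "?P \<longleftrightarrow> _")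
proof
  have Mod: "group (G\<lparr>carrier := H\<rparr> Mod K)" "order (G\<lparr>carrier := H\<rparr> Mod K) * card K = card H" "card K \<noteq> 0"
    if "chief_factor G H K" for H K
  proof -
    have *: "subgroup H G" "K \<lhd> G" "K \<subseteq> H"
      using that by (auto simp: chief_factor_def normal_imp_subgroup)
    from card_Mod[OF this] show "group (G\<lparr>carrier := H\<rparr> Mod K)" "order (G\<lparr>carrier := H\<rparr> Mod K) * card K = card H"
      by simp_all
    show "card K \<noteq> 0"
      using subgroup.finite_imp_card_positive[OF normal_imp_subgroup assms] * by simp
  qed
  show "prime_chain G N" if ?P
  proof (rule prime_chainI[OF assms])
    show "N \<lhd> G" using that by blast
    fix H K assume c: "chief_factor G H K" "H \<subseteq> N"
    then have "Factorial_Ring.prime (order (G\<lparr>carrier := H\<rparr> Mod K))" using that by blast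
    then show "\<exists>q. Factorial_Ring.prime q \<and> card H = q * card K" using Mod(2)[OF c(1)] by auto
  qed
  show ?P if pc: "prime_chain G N"
  proof (intro conjI allI impI)
    show "N \<lhd> G" using pc by (rule prime_chain_normal)
    fix H K assume "chief_factor G H K \<and> H \<subseteq> N"
    then have c: "chief_factor G H K" "H \<subseteq> N" by auto
    obtain q where q: "Factorial_Ring.prime q" "card H = q * card K"
      using prime_chain_chief_factor[OF assms pc c] .
    then show "Factorial_Ring.prime (order (G\<lparr>carrier := H\<rparr> Mod K))"
      using Mod(2,3)[OF c(1)] by simp
    then show "cyclic_group (G\<lparr>carrier := H\<rparr> Mod K)"
      by (rule group.prime_order_imp_cyclic[OF Mod(1)[OF c(1)]])
  qed
qed

end

text \<open>Closure under products makes the family of subgroups with a prime chain directed, and it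
  is finite, so its greatest element is itself a member.\<close>

lemma prime_chain_hypercenter:
  fixes G :: "'a monoid" (structure)
  assumes "group G" "finite (carrier G)"
  shows "prime_chain G (supersolvable_hypercenter G)"
proof -
  interpret group G by fact
  have "supersolvable_hypercenter G = Greatest (prime_chain G)"
    unfolding supersolvable_hypercenter_def hypercentral_iff_prime_chain[OF assms] ..
  moreover have "prime_chain G (Greatest (prime_chain G))"
  proof (rule Greatest_set_directed)
    have "{N. prime_chain G N} \<subseteq> Pow (carrier G)"
      using prime_chain_normal normal_imp_subgroup subgroup.subset by blast
    then show "finite {N. prime_chain G N}" by (rule finite_subset) (simp add: assms(2))
    show "prime_chain G {\<one>}" by (rule prime_chain.trivial)
    show "\<exists>C. prime_chain G C \<and> A \<subseteq> C \<and> B \<subseteq> C" if "prime_chain G A" "prime_chain G B" for A B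
      using prime_chain_set_mult[OF assms(2) that(2,1)]
        set_mult_upper[OF prime_chain_normal[OF that(1), THEN normal_imp_subgroup]
          prime_chain_normal[OF that(2), THEN normal_imp_subgroup]] by blast
  qed
  ultimately show ?thesis by simp
qed

text \<open>By the product formula a product of two normal \<open>p\<close>-subgroups has
  \<open>p\<close>-power order, so the family is directed.\<close>

lemma p_core_greatest:
  fixes G :: "'a monoid" (structure)
  assumes "group G" "finite (carrier G)" "Factorial_Ring.prime p"
  shows "p_core p G \<lhd> G" "p_subgroup p (p_core p G) G"
    and "\<And>N. \<lbrakk>N \<lhd> G; p_subgroup p N G\<rbrakk> \<Longrightarrow> N \<subseteq> p_core p G"
proof -
  interpret group G by fact
  let ?P = "\<lambda>N. N \<lhd> G \<and> p_subgroup p N G"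
  have "{N. ?P N} \<subseteq> Pow (carrier G)"
    using normal_imp_subgroup subgroup.subset by blast
  then have fin: "finite {N. ?P N}" by (rule finite_subset) (simp add: assms(2))
  have triv: "?P {\<one>}"
    by (auto simp: one_is_normal p_subgroup_def normal_imp_subgroup intro: exI[of _ 0])
  have dir: "\<exists>C. ?P C \<and> A \<subseteq> C \<and> B \<subseteq> C" if A: "?P A" and B: "?P B" for A B
  proof -
    obtain a b where ab: "card A = p ^ a" "card B = p ^ b" using A B by (auto simp: p_subgroup_def)
    then have "card (A <#> B) dvd p ^ (a + b)"
      using card_set_mult[OF assms(2)] A B by (metis p_subgroup_def dvd_triv_left power_add)
    then obtain c where "card (A <#> B) = p ^ c" using assms(3) by (metis divides_primepow_nat)
    then have "?P (A <#> B)" using A B normal_set_mult normal_imp_subgroup by (auto simp: p_subgroup_def)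
    then show ?thesis using set_mult_upper[of A B] A B normal_imp_subgroup by blast
  qed
  note G = Greatest_set_directed[of ?P, OF fin triv dir, folded p_core_def]
  show "p_core p G \<lhd> G" "p_subgroup p (p_core p G) G" using G(1) by auto
  show "\<And>N. \<lbrakk>N \<lhd> G; p_subgroup p N G\<rbrakk> \<Longrightarrow> N \<subseteq> p_core p G" using G(2) by auto
qed

section \<open>Action on a chain of factors of prime order\<close>

context
  fixes G :: "'a monoid" (structure)
  assumes group: "group G" and finite_carrier: "finite (carrier G)"
begin

interpretation group G by (rule group)

lemma sylow_subgroup_exists:
  assumes "Factorial_Ring.prime r"
  shows "\<exists>R. sylow_subgroup r R G"
proof -
  obtain m where "order G = r ^ multiplicity r (order G) * m"
    using multiplicity_dvd[of r "order G"] by (auto simp: dvd_def)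
  then obtain R where "subgroup R G" "card R = r ^ multiplicity r (order G)"
    using sylow_thm[OF assms is_group _ finite_carrier] by blast
  then show ?thesis by (auto simp: sylow_subgroup_def)
qed

lemma order_nonzero: "order G \<noteq> 0"
  using finite_carrier by (auto simp: order_def card_eq_0_iff)

lemma sylow_subgroup_index:
  assumes "sylow_subgroup p S G" "Factorial_Ring.prime p"
  shows "\<not> p dvd card (rcosets S)"
proof
  assume "p dvd card (rcosets S)"
  moreover have "card (rcosets S) * card S = order G"
    using assms(1) lagrange unfolding sylow_subgroup_def by blast
  ultimately have "p ^ Suc (multiplicity p (order G)) dvd order G"
    using assms(1) by (metis mult_dvd_mono dvd_refl power_Suc sylow_subgroup_def)
  then have "Suc (multiplicity p (order G)) \<le> multiplicity p (order G)"
    using assms(2) order_nonzero by (intro multiplicity_geI) (auto simp: not_prime_unit)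
  then show False by simp
qed

text \<open>\<open>card T\<close> divides \<open>card D\<close>, which divides
  \<open>order G\<close>; hence \<open>p\<close> has the same exponent in both orders.\<close>

lemma sylow_subgroup_restrict:
  assumes "sylow_subgroup p T G" "Factorial_Ring.prime p" "subgroup D G" "T \<subseteq> D"
  shows "sylow_subgroup p T (G\<lparr>carrier := D\<rparr>)"
proof -
  have T: "subgroup T G" "card T = p ^ multiplicity p (order G)"
    using assms(1) by (simp_all add: sylow_subgroup_def)
  have D: "card D dvd order G" "card D \<noteq> 0"
    using lagrange[OF assms(3)] subgroup.finite_imp_card_positive[OF assms(3) finite_carrier]
    by (metis dvd_triv_right, simp)
  have "card T dvd card D" by (rule card_subgroup_dvd[OF T(1) assms(3,4)])
  then have "multiplicity p (order G) \<le> multiplicity p (card D)"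
    using T(2) D(2) assms(2) by (intro multiplicity_geI) (auto simp: not_prime_unit)
  moreover have "multiplicity p (card D) \<le> multiplicity p (order G)"
    using D order_nonzero by (intro dvd_imp_multiplicity_le)
  ultimately show ?thesis
    using T assms(3,4) by (simp add: sylow_subgroup_def subgroup_incl order_def)
qed

lemma sylow_conjugate:
  assumes "sylow_subgroup p S G" "Factorial_Ring.prime p" "subgroup P G" "card P = p ^ k"
  shows "\<exists>g\<in>carrier G. conj_by G g ` P \<subseteq> S"
  using sylow_contains_conjugate[OF assms(3,4,2) _ finite_carrier sylow_subgroup_index[OF assms(1,2)]]
    assms(1) by (simp add: sylow_subgroup_def)

text \<open>Some conjugate of \<open>P\<close> lies in \<open>S\<close>, and by normality that
  conjugate is \<open>P\<close>.\<close>

lemma normal_p_subgroup_le_sylow: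
  assumes "sylow_subgroup p S G" "Factorial_Ring.prime p" "P \<lhd> G" "card P = p ^ k"
  shows "P \<subseteq> S"
proof -
  have P: "subgroup P G" using assms(3) by (rule normal_imp_subgroup)
  obtain g where g: "g \<in> carrier G" "conj_by G g ` P \<subseteq> S"
    using sylow_conjugate[OF assms(1,2) P assms(4)] by blast
  have "conj_by G g ` P = P"
    using g(1) assms(3) subgroup.subset[OF P] finite_carrier
    by (intro conj_by_image_eqI) (auto simp: normal_iff_conj_by finite_subset)
  then show ?thesis using g(2) by simp
qed

end

section \<open>The stabilizer of a prime chain\<close>

context
  fixes G :: "'a monoid" (structure)
  assumes group: "group G" and finite_carrier: "finite (carrier G)"
begin

interpretation group G by (rule group)

lemma subgroup_nat_pow_closed: "\<lbrakk>subgroup H G; x \<in> H\<rbrakk> \<Longrightarrow> x [^] (n::nat) \<in> H"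
  by (induction n) (auto simp: subgroup.one_closed subgroup.m_closed)

text \<open>By Bezout \<open>m * u = n * v + 1\<close>, so \<open>x\<close> is the
  \<open>u\<close>-th power of \<open>x [^] m\<close>.\<close>

lemma mem_if_coprime_powers_mem:
  assumes "subgroup C G" "x \<in> carrier G" "x [^] (m::nat) \<in> C" "x [^] (n::nat) = \<one>" "coprime m n" "m \<noteq> 0"
  shows "x \<in> C"
proof -
  obtain u v where uv: "m * u = n * v + 1" using bezout_nat[OF assms(6), of n] assms(5) by auto
  have "(x [^] m) [^] u \<in> C"
    using assms(1,3) by (rule subgroup_nat_pow_closed)
  also have "(x [^] m) [^] u = x [^] (n * v + 1)" using assms(2) by (simp add: nat_pow_pow uv)
  also have "\<dots> = x" using assms(2,4) by (simp flip: nat_pow_mult nat_pow_pow)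
  finally show ?thesis .
qed

lemma pow_card_subgroup_eq_one:
  assumes "subgroup H G" "x \<in> H"
  shows "x [^] card H = \<one>"
  using group.pow_order_eq_1[OF subgroup_imp_group[OF assms(1)], of x] assms
  by (simp add: order_def nat_pow_consistent[symmetric])

lemma centralizer_normal:
  assumes "B \<lhd> G"
  shows "{c \<in> carrier G. \<forall>x\<in>B. conj_by G c x = x} \<lhd> G"
proof -
  let ?C = "{c \<in> carrier G. \<forall>x\<in>B. conj_by G c x = x}"
  note B = subgroup.mem_carrier[OF normal_imp_subgroup[OF assms]]
  have "subgroup ?C G"
  proof (rule subgroupI)
    show "inv a \<in> ?C" if "a \<in> ?C" for a
      using that B by (auto) (metis conj_by_inv_cancel(1))
    show "a \<otimes> b \<in> ?C" if "a \<in> ?C" "b \<in> ?C" for a b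
      using that B by (auto simp: conj_by_mult)
    show "?C \<noteq> {}" using B by (auto intro!: exI[of _ \<one>])
  qed auto
  moreover have "conj_by G g c \<in> ?C" if g: "g \<in> carrier G" and c: "c \<in> ?C" for g c
  proof -
    have "conj_by G (conj_by G g c) x = x" if x: "x \<in> B" for x
    proof -
      let ?y = "conj_by G (inv g) x"
      have y: "?y \<in> B" using assms g x by (simp add: normal_iff_conj_by)
      have "conj_by G (conj_by G g c) x = conj_by G g (conj_by G c ?y)"
        using g c B[OF x] by (simp add: conj_by_def[of G g c] conj_by_mult)
      also have "\<dots> = x" using c y g B[OF x] by simp
      finally show ?thesis .
    qed
    then show ?thesis using g c by simp
  qed
  ultimately show ?thesis unfolding normal_iff_conj_by by blast
qed

text \<open>Here \<open>z\<close> is the commutator of \<open>h\<close> and \<open>e\<close>. Since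
  \<open>e\<close> fixes \<open>z\<close>, every further conjugation by \<open>e\<close> contributes
  one more factor \<open>z\<close>.\<close>

lemma conj_by_pow:
  assumes "e \<in> carrier G" "h \<in> carrier G" "z \<in> carrier G" "conj_by G e h = h \<otimes> z" "conj_by G e z = z"
  shows "conj_by G (e [^] (n::nat)) h = h \<otimes> z [^] n"
proof (induction n)
  case (Suc n)
  have "conj_by G e (z [^] k) = z [^] k" for k :: nat
    using assms by (induction k) (auto simp: conj_by_distrib conj_by_def[of G e \<one>])
  then have "conj_by G (e [^] Suc n) h = h \<otimes> (z \<otimes> z [^] n)"
    using assms Suc by (simp add: conj_by_mult conj_by_distrib m_assoc)
  then show ?case using assms nat_pow_Suc2 by simp
qed (use assms in simp)

text \<open>
  \<open>D\<close> consists of the elements acting trivially on all factors of the chain; it induces a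
  \<open>p\<close>-group of automorphisms on \<open>B\<close>.
\<close>

lemma prime_chain_stabilizer:
  assumes "prime_chain G B" "card B = p ^ b" "Factorial_Ring.prime p" "subgroup T G" "card T = p ^ t"
  shows "\<exists>D. D \<lhd> G \<and> T \<subseteq> D \<and> {c \<in> carrier G. \<forall>x\<in>B. conj_by G c x = x} \<subseteq> D \<and>
    (\<forall>d\<in>D. \<exists>k::nat. \<forall>x\<in>B. conj_by G (d [^] (p ^ k)) x = x)"
  using assms(1,2)
proof (induction arbitrary: b rule: prime_chain.induct)
  case trivial
  have "\<exists>k::nat. \<forall>x\<in>{\<one>}. conj_by G (d [^] (p ^ k)) x = x" if "d \<in> carrier G" for d
    using that by (simp add: conj_by_def)
  moreover have "carrier G \<lhd> G" by (simp add: normal_iff_conj_by subgroup_self)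
  ultimately show ?case using subgroup.subset[OF assms(4)] by blast
next
  case (step K H q)
  have K: "K \<lhd> G" using step(1) by (rule prime_chain_normal)
  note sK = normal_imp_subgroup[OF K] and sH = normal_imp_subgroup[OF step(2)]
  note mK = subgroup.mem_carrier[OF sK] and mH = subgroup.mem_carrier[OF sH]
  \<comment> \<open>All orders in the chain are powers of \<open>p\<close>, so the prime of this
    step is \<open>p\<close> itself; only then does \<open>T\<close> centralize the factor.\<close>
  have "q dvd p ^ b" using step(5) step.prems by (metis dvd_triv_left)
  then have q: "q = p" using assms(3) step(4) by (metis prime_dvd_power primes_dvd_imp_eq)
  have "card K dvd p ^ b" using step(5) step.prems by (metis dvd_triv_right)
  then obtain j where j: "card K = p ^ j" using assms(3) by (metis divides_primepow_nat)
  from step.IH[OF j] obtain D where D: "D \<lhd> G" "T \<subseteq> D"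
      "{c \<in> carrier G. \<forall>x\<in>K. conj_by G c x = x} \<subseteq> D"
      "\<And>d. d \<in> D \<Longrightarrow> \<exists>k::nat. \<forall>x\<in>K. conj_by G (d [^] (p ^ k)) x = x"
    by blast
  note sD = normal_imp_subgroup[OF D(1)]
  note mD = subgroup.mem_carrier[OF sD]
  \<comment> \<open>Within the group found for \<open>K\<close>, these are the elements that act
    trivially on the cosets of \<open>K\<close> in \<open>H\<close>.\<close>
  let ?D = "{d \<in> D. \<forall>h\<in>H. inv h \<otimes> conj_by G d h \<in> K}"
  have cH: "conj_by G d h \<in> H" if "d \<in> carrier G" "h \<in> H" for d h
    using step(2) that by (simp add: normal_iff_conj_by)
  have cK: "conj_by G d h \<in> K" if "d \<in> carrier G" "h \<in> K" for d h
    using K that by (simp add: normal_iff_conj_by)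
  have subD: "subgroup ?D G"
  proof (rule subgroupI)
    show "?D \<subseteq> carrier G" using mD by blast
    have "\<one> \<in> ?D" using mH by (auto simp: subgroup.one_closed[OF sD] subgroup.one_closed[OF sK])
    then show "?D \<noteq> {}" by blast
    fix a assume a: "a \<in> ?D"
    then have ca: "a \<in> carrier G" using mD by blast
    have "inv h \<otimes> conj_by G (inv a) h \<in> K" if h: "h \<in> H" for h
    proof -
      let ?h = "conj_by G (inv a) h"
      have h': "?h \<in> H" using cH ca h by simp
      then have "inv (inv ?h \<otimes> conj_by G a ?h) \<in> K" using a subgroup.m_inv_closed[OF sK] by blast
      then show ?thesis using ca mH[OF h] mH[OF h'] by (simp add: inv_mult_group)
    qed
    then show "inv a \<in> ?D" using a subgroup.m_inv_closed[OF sD] by blast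
    fix b assume b: "b \<in> ?D"
    then have cb: "b \<in> carrier G" using mD by blast
    have "inv h \<otimes> conj_by G (a \<otimes> b) h \<in> K" if h: "h \<in> H" for h
    proof -
      let ?h = "conj_by G a h"
      have h': "?h \<in> H" using cH ca h by simp
      have "(inv h \<otimes> ?h) \<otimes> (inv ?h \<otimes> conj_by G b ?h) \<in> K"
        using a b h h' by (blast intro: subgroup.m_closed[OF sK])
      also have "(inv h \<otimes> ?h) \<otimes> (inv ?h \<otimes> conj_by G b ?h) = inv h \<otimes> (?h \<otimes> inv ?h) \<otimes> conj_by G b ?h"
        using ca cb mH[OF h] mH[OF h'] by (simp only: m_assoc m_closed inv_closed conj_by_closed)
      also have "\<dots> = inv h \<otimes> conj_by G (a \<otimes> b) h"
        using ca cb mH[OF h] mH[OF h'] by (simp add: conj_by_mult)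
      finally show ?thesis .
    qed
    then show "a \<otimes> b \<in> ?D" using a b subgroup.m_closed[OF sD] by blast
  qed
  have "?D \<lhd> G" unfolding normal_iff_conj_by
  proof (intro conjI ballI subD)
    fix g d assume g: "g \<in> carrier G" and d: "d \<in> ?D"
    have cd: "d \<in> carrier G" using d mD by blast
    have "inv h \<otimes> conj_by G (conj_by G g d) h \<in> K" if h: "h \<in> H" for h
    proof -
      let ?y = "conj_by G (inv g) h"
      have y: "?y \<in> H" using cH g h by simp
      have "conj_by G g (inv ?y \<otimes> conj_by G d ?y) \<in> K" using d y cK g by blast
      also have "conj_by G g (inv ?y \<otimes> conj_by G d ?y) = inv h \<otimes> conj_by G g (conj_by G d ?y)"
        using g cd mH[OF h] mH[OF y] by (simp add: conj_by_distrib conj_by_inv)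
      also have "conj_by G g (conj_by G d ?y) = conj_by G (conj_by G g d) h"
        using g cd mH[OF h] by (simp add: conj_by_def[of G g d] conj_by_mult)
      finally show ?thesis .
    qed
    moreover have "conj_by G g d \<in> D" using D(1) g d by (simp add: normal_iff_conj_by)
    ultimately show "conj_by G g d \<in> ?D" by blast
  qed
  moreover have "T \<subseteq> ?D"
    using D(2) p_subgroup_centralizes_factor_of_order_p[OF finite_carrier assms(3-5) step(2) K step(3)]
      step(5) q by blast
  moreover have "{c \<in> carrier G. \<forall>x\<in>H. conj_by G c x = x} \<subseteq> ?D"
    using D(3) step(3) mH subgroup.one_closed[OF sK] by auto
  moreover have "\<exists>k::nat. \<forall>x\<in>H. conj_by G (d [^] (p ^ k)) x = x" if d: "d \<in> ?D" for d
  proof -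
    have cd: "d \<in> carrier G" using d mD by blast
    obtain k :: nat where k: "\<forall>x\<in>K. conj_by G (d [^] (p ^ k)) x = x" using D(4) d by blast
    let ?e = "d [^] (p ^ k)"
    have e: "?e \<in> carrier G" "?e \<in> ?D"
      using cd subgroup_nat_pow_closed[OF subD d] by simp_all
    \<comment> \<open>The power \<open>?e\<close> fixes \<open>K\<close> pointwise and multiplies
      \<open>h\<close> by some \<open>?z\<close> in \<open>K\<close>. Its \<open>p ^ j\<close>-th
      power therefore multiplies \<open>h\<close> by \<open>?z [^] card K\<close>, which is 1. The
      exponent \<open>k + j\<close> does not depend on \<open>h\<close>.\<close>
    have "conj_by G (d [^] (p ^ (k + j))) h = h" if h: "h \<in> H" for h
    proof -
      let ?z = "inv h \<otimes> conj_by G ?e h"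
      have z: "?z \<in> K" using e(2) h by blast
      have "conj_by G (?e [^] (p ^ j)) h = h \<otimes> ?z [^] (p ^ j)"
      proof (rule conj_by_pow[OF e(1) mH[OF h] mK[OF z]])
        show "conj_by G ?e h = h \<otimes> ?z" using e(1) mH[OF h] by (simp add: m_assoc[symmetric])
        show "conj_by G ?e ?z = ?z" using k z by blast
      qed
      also have "?z [^] (p ^ j) = \<one>" using pow_card_subgroup_eq_one[OF sK z] j by simp
      finally show ?thesis using mH[OF h] cd by (simp add: nat_pow_pow power_add)
    qed
    then show ?thesis by blast
  qed
  ultimately show ?case by blast
qed

text \<open>The order of \<open>T <#> C\<close> is divisible by the full power of each prime in
  \<open>card D\<close>. For \<open>p\<close> the subgroup \<open>T\<close> supplies it. For another
  prime \<open>r\<close>, an element of a Sylow \<open>r\<close>-subgroup of \<open>D\<close> has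
  \<open>r\<close>-power order and some \<open>p\<close>-power of it lies in \<open>C\<close>, so it
  lies in \<open>C\<close> itself.\<close>

lemma prime_chain_stabilizer_factorization:
  assumes "D \<lhd> G" "C \<lhd> G" "C \<subseteq> D" "T \<subseteq> D" "sylow_subgroup p T G" "Factorial_Ring.prime p"
    and "\<And>d. d \<in> D \<Longrightarrow> \<exists>k::nat. d [^] (p ^ k) \<in> C"
  shows "T <#> C = D"
proof -
  have T: "subgroup T G" using assms(5) by (simp add: sylow_subgroup_def)
  note D = normal_imp_subgroup[OF assms(1)] and C = normal_imp_subgroup[OF assms(2)]
  let ?D = "G\<lparr>carrier := D\<rparr>"
  have E: "subgroup (T <#> C) G"
    using mult_norm_subgroup[OF assms(2) T] commut_normal[OF T assms(2)] by simp
  have ED: "T <#> C \<subseteq> D"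
    using assms(3,4) subgroup.m_closed[OF D] by (auto simp: set_mult_def)
  have finD: "finite D" using finite_subset[OF subgroup.subset[OF D] finite_carrier] .
  have D0: "card D \<noteq> 0" "card (T <#> C) \<noteq> 0"
    using subgroup.finite_imp_card_positive[OF D finite_carrier]
      subgroup.finite_imp_card_positive[OF E finite_carrier] by simp_all
  have "card D dvd card (T <#> C)"
  proof (rule multiplicity_le_imp_dvd[OF D0(1)])
    fix r :: nat assume r: "Factorial_Ring.prime r"
    have "\<exists>R. subgroup R G \<and> R \<subseteq> T <#> C \<and> card R = r ^ multiplicity r (card D)"
    proof (cases "r = p")
      case True
      then have "card T = r ^ multiplicity r (card D)"
        using sylow_subgroup_restrict[OF group finite_carrier assms(5,6) D assms(4)] by (simp add: sylow_subgroup_def order_def)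
      then show ?thesis using T set_mult_upper[OF T C] by blast
    next
      case False
      obtain R where R: "subgroup R ?D" "card R = r ^ multiplicity r (card D)"
        using sylow_subgroup_exists[OF subgroup_imp_group[OF D] _ r] finD
        by (auto simp: sylow_subgroup_def order_def)
      have R': "subgroup R G" "R \<subseteq> D" using incl_subgroup[OF D R(1)] subgroup.subset[OF R(1)] by simp_all
      have "x \<in> C" if x: "x \<in> R" for x
      proof -
        obtain k :: nat where k: "x [^] (p ^ k) \<in> C" using assms(7) R'(2) x by blast
        have "x [^] (r ^ multiplicity r (card D)) = \<one>" using pow_card_subgroup_eq_one[OF R'(1) x] R(2) by simp
        moreover have "coprime (p ^ k) (r ^ multiplicity r (card D))"
          using False r assms(6) by (simp add: primes_coprime)
        moreover have "p ^ k \<noteq> 0" using assms(6) by (simp add: prime_gt_0_nat)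
        ultimately show ?thesis
          using mem_if_coprime_powers_mem[OF C subgroup.mem_carrier[OF R'(1) x] k] by blast
      qed
      then have "R \<subseteq> T <#> C" using set_mult_upper[OF T C] by blast
      then show ?thesis using R' R(2) by blast
    qed
    then have "r ^ multiplicity r (card D) dvd card (T <#> C)" using card_subgroup_dvd[OF _ E] by metis
    then show "multiplicity r (card D) \<le> multiplicity r (card (T <#> C))"
      using D0 r by (intro multiplicity_geI) (auto simp: not_prime_unit)
  qed
  then have "card D \<le> card (T <#> C)" using D0 by (simp add: dvd_imp_le)
  then show ?thesis using ED finD by (simp add: card_seteq)
qed

text \<open>Frattini argument: \<open>T\<close> and its conjugate by \<open>n\<close> both lie in
  the normal subgroup \<open>D\<close>, so \<open>n \<otimes> d\<close> normalizes \<open>T\<close>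
  for some \<open>d\<close> in \<open>D\<close>. Writing \<open>inv d = t \<otimes> c\<close> with
  \<open>t\<close> in \<open>T\<close> and \<open>c\<close> centralizing \<open>B\<close> gives
  \<open>n = ?m \<otimes> c\<close>, where \<open>?m\<close> normalizes \<open>T\<close> and agrees
  with \<open>n\<close> on \<open>B\<close>.\<close>

lemma prime_chain_sylow_fusion:
  assumes "prime_chain G B" "card B = p ^ b" "Factorial_Ring.prime p" "sylow_subgroup p T G" "n \<in> carrier G"
  shows "\<exists>m\<in>carrier G. conj_by G m ` T = T \<and> (\<forall>x\<in>B. conj_by G n x = conj_by G m x)"
proof -
  let ?C = "{c \<in> carrier G. \<forall>x\<in>B. conj_by G c x = x}"
  have B: "B \<lhd> G" using assms(1) by (rule prime_chain_normal)
  have C: "?C \<lhd> G" using B by (rule centralizer_normal)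
  have T: "subgroup T G" "card T = p ^ multiplicity p (order G)"
    using assms(4) by (simp_all add: sylow_subgroup_def)
  note mT = subgroup.mem_carrier[OF T(1)]
  obtain D where D: "D \<lhd> G" "T \<subseteq> D" "?C \<subseteq> D"
      "\<And>d. d \<in> D \<Longrightarrow> \<exists>k::nat. \<forall>x\<in>B. conj_by G (d [^] (p ^ k)) x = x"
    using prime_chain_stabilizer[OF assms(1-3) T] by blast
  note sD = normal_imp_subgroup[OF D(1)]
  have TC: "T <#> ?C = D"
  proof (rule prime_chain_stabilizer_factorization[OF D(1) C D(3,2) assms(4,3)])
    show "\<exists>k::nat. d [^] (p ^ k) \<in> ?C" if "d \<in> D" for d
      using D(4)[OF that] subgroup.mem_carrier[OF sD that] by auto
  qed
  let ?D = "G\<lparr>carrier := D\<rparr>"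
  have gD: "group ?D" using sD by (rule subgroup_imp_group)
  have finD: "finite (carrier ?D)" using finite_subset[OF subgroup.subset[OF sD] finite_carrier] by simp
  have nT: "conj_by G n ` T \<subseteq> D" using D(1,2) assms(5) by (auto simp: normal_iff_conj_by)
  have "\<exists>d\<in>carrier ?D. conj_by ?D d ` (conj_by G n ` T) \<subseteq> T"
  proof (rule sylow_conjugate[OF gD finD sylow_subgroup_restrict[OF group finite_carrier assms(4,3) sD D(2)] assms(3)])
    show "subgroup (conj_by G n ` T) ?D"
      using nT by (intro subgroup_incl subgroup_conj_by_image T assms sD)
    show "card (conj_by G n ` T) = p ^ multiplicity p (order G)"
      using T assms(5) by (simp add: card_conj_by_image subgroup.subset)
  qed
  then obtain d where d: "d \<in> D" "conj_by G d ` (conj_by G n ` T) \<subseteq> T"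
    using conj_by_subgroup[OF sD] by auto
  then have cd: "d \<in> carrier G" using subgroup.mem_carrier[OF sD] by blast
  then have "inv d \<in> T <#> ?C" unfolding TC using d subgroup.m_inv_closed[OF sD] by blast
  then obtain t c where tc: "t \<in> T" "c \<in> ?C" "inv d = t \<otimes> c" by (auto simp: set_mult_def)
  let ?m = "n \<otimes> d \<otimes> t"
  have m: "?m \<in> carrier G" using assms(5) cd mT tc by simp
  have n: "n = ?m \<otimes> c"
  proof -
    have "n = n \<otimes> d \<otimes> inv d" using assms(5) cd by (simp add: m_assoc)
    then show ?thesis using tc assms(5) cd mT by (simp add: m_assoc)
  qed
  have "conj_by G ?m ` T \<subseteq> T"
  proof
    fix y assume "y \<in> conj_by G ?m ` T"
    then obtain x where x: "x \<in> T" "y = conj_by G ?m x" by blast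
    then have "y = conj_by G t (conj_by G d (conj_by G n x))"
      using assms(5) cd mT tc by (simp add: conj_by_mult)
    moreover have "conj_by G d (conj_by G n x) \<in> T" using d x by blast
    ultimately show "y \<in> T" using tc T(1) by (simp add: conj_by_def subgroup.m_closed subgroup.m_inv_closed)
  qed
  then have "conj_by G ?m ` T = T"
    using m T(1) finite_carrier by (intro conj_by_image_eqI) (auto intro: finite_subset subgroup.subset mT)
  moreover have "conj_by G n x = conj_by G ?m x" if x: "x \<in> B" for x
  proof -
    have cx: "x \<in> carrier G" using x B normal_imp_subgroup subgroup.mem_carrier by metis
    have "conj_by G n x = conj_by G c (conj_by G ?m x)"
      using n m tc cx by (metis (no_types, lifting) conj_by_mult mem_Collect_eq)
    also have "\<dots> = conj_by G ?m x" using tc B x m by (simp add: normal_iff_conj_by)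
    finally show ?thesis .
  qed
  ultimately show ?thesis using m by blast
qed

end

section \<open>Control of fusion by the Sylow normalizer\<close>

definition conj_normalizer :: "('a, 'b) monoid_scheme \<Rightarrow> 'a set \<Rightarrow> 'a set" where
  "conj_normalizer G B = {g \<in> carrier G. conj_by G g ` B = B}"

context group
begin

lemma image_conj_by_mult:
  "\<lbrakk>g \<in> carrier G; h \<in> carrier G; B \<subseteq> carrier G\<rbrakk> \<Longrightarrow>
    conj_by G (g \<otimes> h) ` B = conj_by G h ` conj_by G g ` B"
  unfolding image_image by (intro image_cong refl) (auto simp: conj_by_mult)

lemma image_conj_by_inv:
  "\<lbrakk>g \<in> carrier G; B \<subseteq> carrier G; conj_by G g ` B = A\<rbrakk> \<Longrightarrow> conj_by G (inv g) ` A = B"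
  using image_conj_by_mult[of g "inv g" B] by (auto simp: image_def subset_iff)

lemma subgroup_conj_normalizer:
  assumes "B \<subseteq> carrier G"
  shows "subgroup (conj_normalizer G B) G"
proof (rule subgroupI)
  have "conj_by G \<one> ` B = B" using assms by (auto simp: image_def subset_iff)
  then show "conj_normalizer G B \<noteq> {}" by (auto simp: conj_normalizer_def)
  show "inv a \<in> conj_normalizer G B" if "a \<in> conj_normalizer G B" for a
    using that image_conj_by_inv[OF _ assms] by (simp add: conj_normalizer_def)
  show "a \<otimes> b \<in> conj_normalizer G B" if "a \<in> conj_normalizer G B" "b \<in> conj_normalizer G B" for a b
    using that assms by (simp add: conj_normalizer_def image_conj_by_mult)
qed (auto simp: conj_normalizer_def)

lemma conj_by_image_subgroup_self:
  assumes "subgroup B G" "b \<in> B" "finite B"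
  shows "conj_by G b ` B = B"
  using assms subgroup.subset[OF assms(1)]
  by (intro conj_by_image_eqI) (auto simp: conj_by_def subgroup.m_closed subgroup.m_inv_closed)

lemma normal_conj_normalizer:
  assumes "subgroup B G" "finite B"
  shows "B \<lhd> G\<lparr>carrier := conj_normalizer G B\<rparr>"
proof -
  note B = subgroup.subset[OF assms(1)]
  let ?N = "conj_normalizer G B"
  note N = subgroup_conj_normalizer[OF B]
  interpret N: group "G\<lparr>carrier := ?N\<rparr>" using N by (rule subgroup_imp_group)
  have "B \<subseteq> ?N" using B conj_by_image_subgroup_self[OF assms(1) _ assms(2)] by (auto simp: conj_normalizer_def)
  then have "subgroup B (G\<lparr>carrier := ?N\<rparr>)" using assms(1) N by (intro subgroup_incl)
  moreover have "conj_by (G\<lparr>carrier := ?N\<rparr>) g x \<in> B" if "g \<in> ?N" "x \<in> B" for g x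
    using that conj_by_subgroup[OF N that(1)] by (auto simp: conj_normalizer_def)
  ultimately show ?thesis unfolding N.normal_iff_conj_by by simp
qed

text \<open>This drives the induction on \<open>card S - card A\<close>: the induction hypothesis
  becomes available for the normalizer of \<open>A\<close> in \<open>S\<close>.\<close>

lemma p_subgroup_normalizer_grows:
  assumes "finite (carrier G)" "Factorial_Ring.prime p" "subgroup S G" "card S = p ^ s" "subgroup A G" "A \<subset> S"
  shows "A \<subset> S \<inter> conj_normalizer G A"
proof -
  let ?S = "G\<lparr>carrier := S\<rparr>"
  have "finite S" using finite_subset[OF subgroup.subset[OF assms(3)] assms(1)] .
  moreover have "subgroup A ?S" using assms by (intro subgroup_incl) auto
  ultimately obtain g where g: "g \<in> S - A" "conj_by ?S g ` A = A"
    using group.p_group_normalizer_grows[OF subgroup_imp_group[OF assms(3)], of p s A] assms(2,4,6)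
    by (auto simp: order_def)
  then have "conj_by G g ` A = A" using conj_by_subgroup[OF assms(3), of g] by simp
  then have "g \<in> S \<inter> conj_normalizer G A"
    using g(1) subgroup.mem_carrier[OF assms(3)] by (simp add: conj_normalizer_def)
  moreover have "A \<subseteq> conj_normalizer G A"
    using conj_by_image_subgroup_self[OF assms(5)] subgroup.mem_carrier[OF assms(5)]
      finite_subset[OF subgroup.subset[OF assms(5)] assms(1)] by (auto simp: conj_normalizer_def)
  ultimately show ?thesis using g(1) assms(6) by blast
qed

end

section \<open>Fully normalized conjugates and Alperin's induction\<close>

context
  fixes G :: "'a monoid" (structure) and p :: nat and S :: "'a set"
  assumes group: "group G" and finite_carrier: "finite (carrier G)"
    and prime: "Factorial_Ring.prime p" and sylow: "sylow_subgroup p S G"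
begin

interpretation group G by (rule group)

lemma sylow_imp_subgroup: "subgroup S G" and card_sylow: "card S = p ^ multiplicity p (order G)"
  using sylow by (simp_all add: sylow_subgroup_def)

lemma finite_sylow: "finite S"
  using finite_subset[OF subgroup.subset[OF sylow_imp_subgroup] finite_carrier] .

lemma card_subgroup_of_sylow:
  assumes "subgroup A G" "A \<subseteq> S"
  shows "\<exists>k. card A = p ^ k"
  using card_subgroup_dvd[OF assms(1) sylow_imp_subgroup assms(2)] card_sylow prime by (metis divides_primepow_nat)

text \<open>A Sylow subgroup \<open>P\<close> of the normalizer of \<open>A\<close> contains the
  normal \<open>p\<close>-subgroup \<open>A\<close>, and some \<open>h\<close> conjugates
  \<open>P\<close> into \<open>S\<close>. Then \<open>h\<close> also takes \<open>A\<close> into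
  \<open>S\<close>, and the image of \<open>P\<close> shows that \<open>S\<close> meets the
  normalizer of the new subgroup in a full Sylow subgroup.\<close>

lemma conjugate_fully_normalized:
  assumes "subgroup A G" "A \<subseteq> S"
  shows "\<exists>h\<in>carrier G. conj_by G h ` A \<subseteq> S \<and>
    sylow_subgroup p (S \<inter> conj_normalizer G (conj_by G h ` A))
      (G\<lparr>carrier := conj_normalizer G (conj_by G h ` A)\<rparr>)"
proof -
  note A = subgroup.subset[OF assms(1)]
  have finA: "finite A" using finite_subset[OF A finite_carrier] .
  let ?N = "conj_normalizer G A"
  note N = subgroup_conj_normalizer[OF A]
  have gN: "group (G\<lparr>carrier := ?N\<rparr>)" using N by (rule subgroup_imp_group)
  have finN: "finite (carrier (G\<lparr>carrier := ?N\<rparr>))"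
    using finite_subset[OF subgroup.subset[OF N] finite_carrier] by simp
  obtain P where P: "sylow_subgroup p P (G\<lparr>carrier := ?N\<rparr>)"
    using sylow_subgroup_exists[OF gN finN prime] by blast
  then have P': "subgroup P G" "P \<subseteq> ?N" "card P = p ^ multiplicity p (card ?N)"
    using incl_subgroup[OF N] subgroup.subset by (fastforce simp: sylow_subgroup_def order_def)+
  obtain k where "card A = p ^ k" using card_subgroup_of_sylow[OF assms] by blast
  then have AP: "A \<subseteq> P"
    using normal_p_subgroup_le_sylow[OF gN finN P prime normal_conj_normalizer[OF assms(1) finA]] by blast
  obtain h where h: "h \<in> carrier G" "conj_by G h ` P \<subseteq> S"
    using sylow_conjugate[OF group finite_carrier sylow prime P'(1,3)] by blast
  let ?B = "conj_by G h ` A"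
  let ?M = "conj_normalizer G ?B"
  have B: "?B \<subseteq> carrier G" using A h(1) by auto
  note M = subgroup_conj_normalizer[OF B]
  \<comment> \<open>Proved for arbitrary \<open>h\<close> and \<open>A'\<close> because it is also
    applied to \<open>inv h\<close>; the two inclusions give normalizers of equal order.\<close>
  have NM: "conj_by G h ` conj_normalizer G A' \<subseteq> conj_normalizer G (conj_by G h ` A')"
    if "h \<in> carrier G" "A' \<subseteq> carrier G" for h A'
  proof
    fix y assume "y \<in> conj_by G h ` conj_normalizer G A'"
    then obtain g where g: "g \<in> carrier G" "conj_by G g ` A' = A'" "y = inv h \<otimes> g \<otimes> h"
      by (auto simp: conj_normalizer_def conj_by_def)
    have "conj_by G h ` A' \<subseteq> carrier G" using that by auto
    then have "conj_by G y ` (conj_by G h ` A') = conj_by G h ` conj_by G g ` conj_by G (inv h) ` conj_by G h ` A'"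
      using g that by (simp add: image_conj_by_mult)
    also have "conj_by G (inv h) ` conj_by G h ` A' = A'"
      using image_conj_by_inv[OF that refl] .
    finally show "y \<in> conj_normalizer G (conj_by G h ` A')"
      using g that by (simp add: conj_normalizer_def)
  qed
  have "conj_by G (inv h) ` ?M \<subseteq> ?N"
    using NM[OF inv_closed[OF h(1)] B] image_conj_by_inv[OF h(1) A refl] by simp
  then have "card ?M \<le> card ?N"
    using card_mono[of ?N "conj_by G (inv h) ` ?M"] finN h(1) subgroup.subset[OF M]
    by (simp add: card_conj_by_image)
  moreover have "card ?N \<le> card ?M"
    using card_mono[OF _ NM[OF h(1) A]] h(1) subgroup.subset[OF N] finite_subset[OF subgroup.subset[OF M] finite_carrier]
    by (simp add: card_conj_by_image)
  ultimately have cardMN: "card ?M = card ?N" by simp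
  have T: "subgroup (S \<inter> ?M) G" using sylow_imp_subgroup M by (rule subgroups_Inter_pair)
  obtain j where j: "card (S \<inter> ?M) = p ^ j" using card_subgroup_of_sylow[OF T] by blast
  have "card ?M \<noteq> 0" using subgroup.finite_imp_card_positive[OF M finite_carrier] by simp
  moreover have "card (S \<inter> ?M) dvd card ?M" by (rule card_subgroup_dvd[OF T M]) simp
  ultimately have "j \<le> multiplicity p (card ?M)"
    using j prime by (intro multiplicity_geI) (auto simp: not_prime_unit)
  moreover have "conj_by G h ` P \<subseteq> S \<inter> ?M" using h(2) P'(2) NM[OF h(1) A] by blast
  then have "card P \<le> card (S \<inter> ?M)"
    using card_mono[of "S \<inter> ?M" "conj_by G h ` P"] finite_sylow h(1) subgroup.subset[OF P'(1)]
    by (simp add: card_conj_by_image)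
  then have "multiplicity p (card ?M) \<le> j"
    using P'(3) j cardMN prime_gt_1_nat[OF prime] by simp
  ultimately have "card (S \<inter> ?M) = p ^ multiplicity p (card ?M)" using j by simp
  then have "sylow_subgroup p (S \<inter> ?M) (G\<lparr>carrier := ?M\<rparr>)"
    using subgroup_incl[OF T M] by (simp add: sylow_subgroup_def order_def)
  moreover have "?B \<subseteq> S" using AP h(2) by blast
  ultimately show ?thesis using h(1) by blast
qed

text \<open>Let \<open>B\<close> be a fully normalized conjugate of a proper subgroup
  \<open>A\<close>. Elements of the normalizer of \<open>S\<close> move both \<open>A\<close> and
  its image under \<open>g\<close> to \<open>B\<close>, which reduces \<open>g\<close> to an element
  normalizing \<open>B\<close>. On \<open>B\<close> that element acts like one normalizing the
  larger group \<open>S \<inter> conj_normalizer G B\<close>, to which the induction hypothesis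
  applies.\<close>

lemma sylow_normalizer_controls_fusion:
  assumes hypercentral: "\<And>B. \<lbrakk>subgroup B G; B \<subset> S; sylow_subgroup p (S \<inter> conj_normalizer G B) (G\<lparr>carrier := conj_normalizer G B\<rparr>)\<rbrakk>
      \<Longrightarrow> prime_chain (G\<lparr>carrier := conj_normalizer G B\<rparr>) B"
    and "subgroup A G" "A \<subseteq> S" "g \<in> carrier G" "conj_by G g ` A \<subseteq> S"
  shows "\<exists>n\<in>conj_normalizer G S. \<forall>x\<in>A. conj_by G g x = conj_by G n x"
  using assms(2-)
proof (induction "card S - card A" arbitrary: A g rule: less_induct)
  case less
  note S = subgroup.subset[OF sylow_imp_subgroup]
  note NS = subgroup_conj_normalizer[OF S]
  note A = subgroup.subset[OF less.prems(1)]
  show ?case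
  proof (cases "A = S")
    case True
    then have "g \<in> conj_normalizer G S"
      using less.prems(3,4) conj_by_image_eqI[OF less.prems(3) S finite_sylow] by (simp add: conj_normalizer_def)
    then show ?thesis by blast
  next
    case False
    then have AS: "A \<subset> S" using less.prems(2) by blast
    then have cardAS: "card A < card S" using finite_sylow by (simp add: psubset_card_mono)
    obtain h where h: "h \<in> carrier G" "conj_by G h ` A \<subseteq> S"
        "sylow_subgroup p (S \<inter> conj_normalizer G (conj_by G h ` A))
          (G\<lparr>carrier := conj_normalizer G (conj_by G h ` A)\<rparr>)"
      using conjugate_fully_normalized[OF less.prems(1,2)] by blast
    define B where "B = conj_by G h ` A"
    let ?N = "conj_normalizer G B" and ?T = "S \<inter> conj_normalizer G B"
    have B: "subgroup B G" "B \<subseteq> S" "card B = card A"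
      using h subgroup_conj_by_image[OF h(1) less.prems(1)] A by (simp_all add: B_def card_conj_by_image)
    then have BS: "B \<subset> S" using cardAS by auto
    have Bc: "B \<subseteq> carrier G" using B(1) by (rule subgroup.subset)
    note N = subgroup_conj_normalizer[OF Bc]
    let ?GN = "G\<lparr>carrier := ?N\<rparr>"
    have gN: "group ?GN" using N by (rule subgroup_imp_group)
    have finN: "finite (carrier ?GN)" using finite_subset[OF subgroup.subset[OF N] finite_carrier] by simp
    have T: "sylow_subgroup p ?T ?GN" using h(3) by (simp add: B_def)
    have Tsub: "subgroup ?T G" using sylow_imp_subgroup N by (rule subgroups_Inter_pair)
    \<comment> \<open>A given \<open>y\<close> taking \<open>A'\<close> to \<open>B\<close> is
      corrected by some \<open>z\<close> normalizing \<open>B\<close>, so that the product takes the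
      whole of \<open>?Q\<close> into \<open>S\<close>. As \<open>?Q\<close> is larger than
      \<open>A'\<close>, the induction hypothesis replaces the product by an element normalizing
      \<open>S\<close>.\<close>
    have to_B: "\<exists>n\<in>conj_normalizer G S. conj_by G n ` A' = B"
      if A': "subgroup A' G" "A' \<subset> S" "card A' = card A" and y: "y \<in> carrier G" "conj_by G y ` A' = B" for A' y
    proof -
      note A'c = subgroup.subset[OF A'(1)]
      let ?Q = "S \<inter> conj_normalizer G A'"
      have Q: "subgroup ?Q G" using sylow_imp_subgroup subgroup_conj_normalizer[OF A'c] by (rule subgroups_Inter_pair)
      note Qc = subgroup.subset[OF Q]
      have AQ: "A' \<subset> ?Q" by (rule p_subgroup_normalizer_grows[OF finite_carrier prime sylow_imp_subgroup card_sylow A'(1,2)])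
      have yQ: "conj_by G y ` ?Q \<subseteq> ?N"
      proof
        fix z assume "z \<in> conj_by G y ` ?Q"
        then obtain q where q: "q \<in> carrier G" "conj_by G q ` A' = A'" "z = inv y \<otimes> q \<otimes> y"
          by (auto simp: conj_normalizer_def conj_by_def)
        then have "conj_by G z ` B = conj_by G y ` conj_by G q ` conj_by G (inv y) ` B"
          using y(1) Bc by (simp add: image_conj_by_mult)
        also have "\<dots> = B" using image_conj_by_inv[OF y(1) A'c y(2)] q(2) y(2) by simp
        finally show "z \<in> ?N" using q y(1) by (simp add: conj_normalizer_def)
      qed
      obtain j where "card ?Q = p ^ j" using card_subgroup_of_sylow[OF Q] by blast
      then have "card (conj_by G y ` ?Q) = p ^ j" using y(1) Qc by (simp add: card_conj_by_image)
      moreover have "subgroup (conj_by G y ` ?Q) ?GN"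
        using subgroup_incl[OF subgroup_conj_by_image[OF y(1) Q] N yQ] .
      ultimately obtain z where z: "z \<in> carrier ?GN" "conj_by ?GN z ` conj_by G y ` ?Q \<subseteq> ?T"
        using sylow_conjugate[OF gN finN T prime] by blast
      then have z': "z \<in> ?N" "conj_by G z ` conj_by G y ` ?Q \<subseteq> S"
        using conj_by_subgroup[OF N, of z] by simp_all
      then have zc: "z \<in> carrier G" "conj_by G z ` B = B" by (simp_all add: conj_normalizer_def)
      have "card S - card ?Q < card S - card A"
        using psubset_card_mono[OF _ AQ] A'(3) cardAS finite_sylow by simp
      moreover have "conj_by G (y \<otimes> z) ` ?Q \<subseteq> S" using z'(2) y(1) zc(1) Qc by (simp add: image_conj_by_mult)
      ultimately obtain n where n: "n \<in> conj_normalizer G S" "\<forall>x\<in>?Q. conj_by G (y \<otimes> z) x = conj_by G n x"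
        using less.hyps[of ?Q "y \<otimes> z"] Q y(1) zc(1) by blast
      have "conj_by G n ` A' = conj_by G (y \<otimes> z) ` A'"
        using n(2) AQ by (intro image_cong refl) auto
      also have "\<dots> = B" using y zc A'c by (simp add: image_conj_by_mult)
      finally show ?thesis using n(1) by blast
    qed
    obtain n1 where n1: "n1 \<in> conj_normalizer G S" "conj_by G n1 ` A = B"
      using to_B[OF less.prems(1) AS refl h(1)] by (auto simp: B_def)
    let ?A2 = "conj_by G g ` A"
    have A2: "subgroup ?A2 G" "card ?A2 = card A"
      using subgroup_conj_by_image[OF less.prems(3,1)] less.prems(3) A by (simp_all add: card_conj_by_image)
    then have A2S: "?A2 \<subset> S" using less.prems(4) cardAS by auto
    have "conj_by G (inv g \<otimes> h) ` ?A2 = B"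
      using less.prems(3) h(1) subgroup.subset[OF A2(1)] image_conj_by_inv[OF less.prems(3) A refl]
      by (simp add: image_conj_by_mult B_def)
    then obtain n2 where n2: "n2 \<in> conj_normalizer G S" "conj_by G n2 ` ?A2 = B"
      using to_B[OF A2(1) A2S A2(2)] less.prems(3) h(1) by blast
    have c: "n1 \<in> carrier G" "n2 \<in> carrier G" using n1(1) n2(1) by (simp_all add: conj_normalizer_def)
    \<comment> \<open>This is \<open>g\<close> transported along \<open>n1\<close> and
      \<open>n2\<close> to a map from \<open>B\<close> to \<open>B\<close>.\<close>
    let ?k = "inv n1 \<otimes> g \<otimes> n2"
    have "conj_by G ?k ` B = B"
      using c less.prems(3) Bc image_conj_by_inv[OF c(1) A n1(2)] n2(2) by (simp add: image_conj_by_mult)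
    then have k: "?k \<in> ?N" using c less.prems(3) by (simp add: conj_normalizer_def)
    obtain b where b: "card B = p ^ b" using card_subgroup_of_sylow[OF B(1,2)] by blast
    have "prime_chain ?GN B" using hypercentral[OF B(1) BS] T by simp
    \<comment> \<open>The prime chain is used here: \<open>?k\<close> need not map \<open>?T\<close>
      into \<open>S\<close>, but \<open>m\<close> does, and both agree on \<open>B\<close>.\<close>
    then obtain m where m: "m \<in> carrier ?GN" "conj_by ?GN m ` ?T = ?T" "\<forall>x\<in>B. conj_by ?GN ?k x = conj_by ?GN m x"
      using prime_chain_sylow_fusion[OF gN finN _ b prime T] k by fastforce
    then have m': "m \<in> carrier G" "conj_by G m ` ?T \<subseteq> S" "\<forall>x\<in>B. conj_by G ?k x = conj_by G m x"
      using conj_by_subgroup[OF N] k subgroup.mem_carrier[OF N] by simp_all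
    have BT: "B \<subset> ?T" by (rule p_subgroup_normalizer_grows[OF finite_carrier prime sylow_imp_subgroup card_sylow B(1) BS])
    have "card S - card ?T < card S - card A"
      using psubset_card_mono[OF _ BT] B(3) cardAS finite_sylow by simp
    then obtain n3 where n3: "n3 \<in> conj_normalizer G S" "\<forall>x\<in>?T. conj_by G m x = conj_by G n3 x"
      using less.hyps[of ?T m] Tsub m' by blast
    then have c3: "n3 \<in> carrier G" by (simp add: conj_normalizer_def)
    \<comment> \<open>The transport along \<open>n1\<close> and \<open>n2\<close> is undone, with
      \<open>n3\<close> in place of \<open>?k\<close>.\<close>
    let ?n = "n1 \<otimes> n3 \<otimes> inv n2"
    have "?n \<in> conj_normalizer G S"
      using n1(1) n2(1) n3(1) NS by (simp add: subgroup.m_closed subgroup.m_inv_closed)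
    moreover have "conj_by G g x = conj_by G ?n x" if x: "x \<in> A" for x
    proof -
      have xc: "x \<in> carrier G" using x A by blast
      let ?x = "conj_by G n1 x"
      have "?x \<in> B" using n1(2) x by blast
      then have "conj_by G n3 ?x = conj_by G ?k ?x" using m'(3) n3(2) BT by auto
      also have "\<dots> = conj_by G n2 (conj_by G g x)" using c xc less.prems(3) by (simp add: conj_by_mult)
      finally show ?thesis using c c3 xc less.prems(3) by (simp add: conj_by_mult)
    qed
    ultimately show ?thesis by blast
  qed
qed

end

section \<open>From prime chains to a series of strongly closed subgroups\<close>

lemma prime_chain_sequence:
  assumes "prime_chain G N"
  shows "\<exists>n T. T 0 = {\<one>\<^bsub>G\<^esub>} \<and> T n = N \<and> (\<forall>i\<le>n. prime_chain G (T i)) \<and>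
    (\<forall>i<n. T i \<subseteq> T (Suc i) \<and> (\<exists>q. Factorial_Ring.prime q \<and> card (T (Suc i)) = q * card (T i)))"
  using assms
proof (induction rule: prime_chain.induct)
  case trivial
  show ?case by (intro exI[of _ 0] exI[of _ "\<lambda>_. {\<one>\<^bsub>G\<^esub>}"]) (simp add: prime_chain.trivial)
next
  case (step K H q)
  from step.IH obtain n T where T: "T 0 = {\<one>\<^bsub>G\<^esub>}" "T n = K" "\<forall>i\<le>n. prime_chain G (T i)"
      "\<forall>i<n. T i \<subseteq> T (Suc i) \<and> (\<exists>q. Factorial_Ring.prime q \<and> card (T (Suc i)) = q * card (T i))"
    by blast
  have "prime_chain G H" by (rule prime_chain.step[OF step(1-5)])
  then show ?case
    using T step(3-5) by (intro exI[of _ "Suc n"] exI[of _ "T(Suc n := H)"]) (auto simp: less_Suc_eq le_Suc_eq)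
qed

text \<open>The core \<open>p_core p ?K\<close> lies in the Sylow subgroup \<open>T\<close> of
  \<open>K\<close>, hence in \<open>S\<close>. So the assumptions on subgroups of \<open>S\<close>
  pass to \<open>K\<close> by the restriction axiom, and the second axiom puts the core into the
  hypercenter. The normal \<open>p\<close>-subgroup \<open>B\<close> lies in the core and inherits a
  prime chain.\<close>

lemma semi_2_eternal_p_core:
  fixes G :: "'a monoid" (structure)
  assumes R: "semi_2_eternal R" and group: "group G" and fin: "finite (carrier G)"
    and prime: "Factorial_Ring.prime p"
    and p: "\<forall>H. subgroup H G \<and> H \<subseteq> S \<and> card H = p \<longrightarrow> R H G"
    and four: "\<forall>H. p = 2 \<and> subgroup H G \<and> H \<subseteq> S \<and> card H = 4 \<and> cyclic_group (G\<lparr>carrier := H\<rparr>) \<longrightarrow> R H G"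
    and K: "subgroup K G" "p dvd card K" and T: "sylow_subgroup p T (G\<lparr>carrier := K\<rparr>)" "T \<subseteq> S"
    and B: "B \<lhd> G\<lparr>carrier := K\<rparr>" "card B = p ^ b"
  shows "prime_chain (G\<lparr>carrier := K\<rparr>) B"
proof -
  interpret group G by (rule group)
  let ?K = "G\<lparr>carrier := K\<rparr>"
  have gK: "group ?K" using K(1) by (rule subgroup_imp_group)
  have finK: "finite (carrier ?K)" using finite_subset[OF subgroup.subset[OF K(1)] fin] by simp
  note core = p_core_greatest[OF gK finK prime]
  obtain k where "card (p_core p ?K) = p ^ k" using core(2) by (auto simp: p_subgroup_def)
  then have coreS: "p_core p ?K \<subseteq> S"
    using normal_p_subgroup_le_sylow[OF gK finK T(1) prime core(1)] T(2) by blast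
  have restrict: "R H ?K" if "R H G" "subgroup H ?K" for H
  proof -
    have "subgroup H G" using incl_subgroup[OF K(1) that(2)] .
    moreover have "H \<subseteq> K" using subgroup.subset[OF that(2)] by simp
    ultimately show ?thesis using R group fin K(1) that(1) unfolding semi_2_eternal_def by blast
  qed
  have "R H ?K" if "subgroup H ?K" "H \<subseteq> p_core p ?K" "card H = p" for H
    using that coreS incl_subgroup[OF K(1) that(1)] by (intro restrict p[rule_format]) auto
  moreover have "R H ?K" if "p = 2" "subgroup H ?K" "H \<subseteq> p_core p ?K" "card H = 4"
    "cyclic_group (?K\<lparr>carrier := H\<rparr>)" for H
    using that coreS incl_subgroup[OF K(1) that(2)] by (intro restrict four[rule_format]) auto
  moreover have "p dvd order ?K" using K(2) by (simp add: order_def)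
  ultimately have "p_core p ?K \<subseteq> supersolvable_hypercenter ?K"
    using R gK finK prime unfolding semi_2_eternal_def by blast
  moreover have "B \<subseteq> p_core p ?K"
    using core(3)[OF B(1)] B by (auto simp: p_subgroup_def normal_imp_subgroup)
  ultimately show ?thesis
    using prime_chain_subset[OF gK finK prime_chain_hypercenter[OF gK finK] B(1)] by blast
qed

theorem theorem3p22:
  fixes R :: "'a set \<Rightarrow> 'a monoid \<Rightarrow> bool"
    and G :: "'a monoid"
    and p :: nat
    and S :: "'a set"
  assumes "semi_2_eternal R"
    and "group G" and "finite (carrier G)"
    and "Factorial_Ring.prime p" and "p dvd order G"
    and "sylow_subgroup p S G"
    and "\<And>H. \<lbrakk>subgroup H G; H \<subseteq> S; card H = p\<rbrakk> \<Longrightarrow> R H G"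
    and "\<And>H. \<lbrakk>p = 2; subgroup H G; H \<subseteq> S; card H = 4; cyclic_group (G\<lparr>carrier := H\<rparr>)\<rbrakk> \<Longrightarrow> R H G"
  shows "supersolvable_fusion_system (group_fusion_system G S)"
proof -
  interpret group G by fact
  have S: "subgroup S G" "card S = p ^ multiplicity p (order G)"
    using assms(6) by (simp_all add: sylow_subgroup_def)
  note Sc = subgroup.subset[OF S(1)]
  have finS: "finite S" using finite_subset[OF Sc assms(3)] .
  have "\<forall>H. subgroup H G \<and> H \<subseteq> S \<and> card H = p \<longrightarrow> R H G"
    and "\<forall>H. p = 2 \<and> subgroup H G \<and> H \<subseteq> S \<and> card H = 4 \<and> cyclic_group (G\<lparr>carrier := H\<rparr>) \<longrightarrow> R H G"
    using assms(7,8) by blast+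
  note p_core = semi_2_eternal_p_core[OF assms(1-4) this]
  have p_power: "\<exists>k. card A = p ^ k" if "subgroup A G" "A \<subseteq> S" for A
    using card_subgroup_dvd[OF that(1) S(1) that(2)] S(2) assms(4) by (metis divides_primepow_nat)
  have hypercentral: "prime_chain (G\<lparr>carrier := conj_normalizer G B\<rparr>) B"
    if B: "subgroup B G" "B \<subset> S"
      and T: "sylow_subgroup p (S \<inter> conj_normalizer G B) (G\<lparr>carrier := conj_normalizer G B\<rparr>)" for B
  proof -
    let ?N = "conj_normalizer G B" and ?T = "S \<inter> conj_normalizer G B"
    note N = subgroup_conj_normalizer[OF subgroup.subset[OF B(1)]]
    have Tsub: "subgroup ?T G" using S(1) N by (rule subgroups_Inter_pair)
    obtain j where j: "card ?T = p ^ j" using p_power[OF Tsub] by blast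
    \<comment> \<open>The second axiom needs \<open>p\<close> to divide the order of the normalizer.
      This holds even for trivial \<open>B\<close>: since \<open>B\<close> is proper in
      \<open>S\<close>, the \<open>p\<close>-group \<open>?T\<close> is larger than \<open>B\<close>
      and so nontrivial.\<close>
    have "card B < card ?T"
      using psubset_card_mono[OF _ p_subgroup_normalizer_grows[OF assms(3,4) S B]] finS by simp
    moreover have "card B > 0" using subgroup.finite_imp_card_positive[OF B(1) assms(3)] .
    ultimately have "j \<noteq> 0" using j by (cases j) auto
    then have "p dvd card ?T" using j by simp
    moreover have "card ?T dvd card ?N" by (rule card_subgroup_dvd[OF Tsub N]) simp
    ultimately have "p dvd card ?N" by (rule dvd_trans)
    moreover obtain b where "card B = p ^ b" using p_power[OF B(1)] B(2) by blast
    ultimately show ?thesis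
      using p_core[OF N _ T _ normal_conj_normalizer[OF B(1) finite_subset[OF _ finS]]] B(2) by blast
  qed
  let ?N = "conj_normalizer G S"
  let ?GN = "G\<lparr>carrier := ?N\<rparr>"
  note N = subgroup_conj_normalizer[OF Sc]
  have gN: "group ?GN" using N by (rule subgroup_imp_group)
  note nS = normal_conj_normalizer[OF S(1) finS]
  have SN: "S \<subseteq> ?N" using subgroup.subset[OF normal_imp_subgroup[OF nS]] by simp
  \<comment> \<open>For \<open>S\<close> itself nothing grows; instead \<open>p\<close> divides
    \<open>card S\<close> because it divides \<open>order G\<close>, and \<open>S\<close> is a
    normal Sylow subgroup of its normalizer.\<close>
  have "prime_chain ?GN S"
  proof (rule p_core[OF N _ sylow_subgroup_restrict[OF assms(2,3,6,4) N SN] order_refl nS S(2)])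
    have "p dvd card S" using S(2) assms(4,5) order_nonzero[OF assms(2,3)]
      by (simp add: prime_multiplicity_gt_zero_iff)
    then show "p dvd card ?N" using card_subgroup_dvd[OF S(1) N SN] by (rule dvd_trans)
  qed
  then obtain n T where T: "T 0 = {\<one>\<^bsub>G\<^esub>}" "T n = S" "\<And>i. i \<le> n \<Longrightarrow> prime_chain ?GN (T i)"
      "\<And>i. i < n \<Longrightarrow> T i \<subseteq> T (Suc i)"
      "\<And>i. i < n \<Longrightarrow> \<exists>q. Factorial_Ring.prime q \<and> card (T (Suc i)) = q * card (T i)"
    using prime_chain_sequence[of ?GN S] by auto
  have nor: "T i \<lhd> ?GN" if "i \<le> n" for i
    using group.prime_chain_normal[OF gN T(3)[OF that]] .
  have TS: "T i \<subseteq> S" if "i \<le> n" for i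
    using that by (induction rule: inc_induct) (use T(2,4) in auto)
  have sub: "subgroup (T i) G" if "i \<le> n" for i
    using incl_subgroup[OF N normal_imp_subgroup[OF nor[OF that]]] .
  let ?F = "group_fusion_system G S"
  have Base: "Base ?F = G\<lparr>carrier := S\<rparr>" by (simp add: group_fusion_system_def)
  \<comment> \<open>Every morphism from \<open>P\<close> is conjugation by some \<open>m\<close>
    normalizing \<open>S\<close>, and \<open>T i\<close> is normal in the normalizer of
    \<open>S\<close>.\<close>
  have closed: "strongly_closed ?F (T i)" if i: "i \<le> n" for i
    unfolding strongly_closed_def Base
  proof (intro conjI allI impI ballI)
    show "subgroup (T i) (G\<lparr>carrier := S\<rparr>)" using subgroup_incl[OF sub[OF i] S(1) TS[OF i]] .
    fix P \<phi> assume P: "subgroup P (G\<lparr>carrier := S\<rparr>) \<and> P \<subseteq> T i"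
      and "\<phi> \<in> Mor ?F P (carrier (G\<lparr>carrier := S\<rparr>))"
    then obtain g where g: "g \<in> carrier G" "\<phi> = (\<lambda>x\<in>P. conj_by G g x)" "conj_by G g ` P \<subseteq> S"
      by (auto simp: group_fusion_system_def conj_by_def)
    have "subgroup P G" "P \<subseteq> S" using incl_subgroup[OF S(1)] P TS[OF i] by auto
    then obtain m where m: "m \<in> ?N" "\<forall>x\<in>P. conj_by G g x = conj_by G m x"
      using sylow_normalizer_controls_fusion[OF assms(2-4,6) hypercentral _ _ g(1,3)] by blast
    have "conj_by G m x \<in> T i" if "x \<in> T i" for x
      using nor[OF i] that m(1) conj_by_subgroup[OF N m(1)] group.normal_iff_conj_by[OF gN] by auto
    then show "\<phi> ` P \<subseteq> T i" using g(2) m(2) P by auto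
  qed
  \<comment> \<open>Normality restricts from \<open>?N\<close> to \<open>T (Suc i)\<close>, and the
    quotient is cyclic because its order is the prime index.\<close>
  have factor: "T i \<lhd> G\<lparr>carrier := T (Suc i)\<rparr> \<and> cyclic_group (G\<lparr>carrier := T (Suc i)\<rparr> Mod T i)"
    if i: "i < n" for i
  proof -
    have subN: "subgroup (T (Suc i)) ?GN" using i by (intro normal_imp_subgroup nor) simp
    have norN: "T i \<lhd> ?GN" using i by (intro nor) simp
    have "T i \<lhd> G\<lparr>carrier := T (Suc i)\<rparr>"
      using group.normal_restrict_supergroup[OF gN subN norN T(4)[OF i]] by simp
    moreover have "cyclic_group (G\<lparr>carrier := T (Suc i)\<rparr> Mod T i)"
    proof -
      let ?Q = "G\<lparr>carrier := T (Suc i)\<rparr> Mod T i"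
      have Q: "group ?Q" "order ?Q * card (T i) = card (T (Suc i))"
        using group.card_Mod[OF gN subN norN T(4)[OF i]] by simp_all
      obtain q where q: "Factorial_Ring.prime q" "card (T (Suc i)) = q * card (T i)"
        using T(5)[OF i] by blast
      moreover have "card (T i) > 0"
        using subgroup.finite_imp_card_positive[OF sub assms(3), of i] i by simp
      ultimately have "order ?Q = q" using Q(2) by simp
      then show ?thesis using group.prime_order_imp_cyclic[OF Q(1)] q(1) by simp
    qed
    ultimately show ?thesis by blast
  qed
  show ?thesis
    unfolding supersolvable_fusion_system_def Base
    using T(1,2,4) closed factor by (intro exI[of _ n] exI[of _ T]) simp
qed

end
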